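(* Suppose that $\mathbf{x}_1,\dotsc,\mathbf{x}_k$ are independent tuples of variables. For each $i$, $1 \leq i \leq k$, let $V_i$ be the complex vector space with basis $\mathbf{x}_i$, and let $F_i(\mathbf{x}_i)$ be a nonzero $d$-form in the variables $\mathbf{x}_i$, or equivalently $0 \neq F_i \in S^d V_i$. Let $F = F_1 + \dotsb + F_k$ and let $V = \bigoplus_{i=1}^k V_i$. Suppose that there exists an integer $1 \leq a \leq d-1$ such that for each $i$, $\operatorname{crk}(F_i) = \dim \operatorname{Derivs}(F_i)_a$. Then $$\operatorname{crk}(F) = \dim \operatorname{Derivs}(F)_a = \sum_{i=1}^k \operatorname{crk}(F_i).$$ If in addition $a \geq 2$, then furthermore every zero-dimensional apolar scheme to $F$ of degree $\operatorname{crk}(F)$ is a union of apolar schemes to the $F_i$. That is, if $Z \subset \mathbb{P}V$ is any zero-dimensional apolar scheme to $F$ of degree $\deg(Z) = \operatorname{crk}(F)$, then $Z = \bigcup_{i=1}^k Z_i$, where each $Z_i \subset \mathbb{P}V_i \subset \mathbb{P}V$ is apolar to $F_i$.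
   Context: All polynomials have complex coefficients. A $d$-form is a homogeneous polynomial of degree $d$. Tuples of variables are independent if they consist of pairwise disjoint sets of variables of one polynomial ring. $\operatorname{Derivs}(F)_a$ is the vector space of $a$-forms spanned by the $(d-a)$th order partial derivatives of the $d$-form $F$. Let $V$ be the vector space with basis $\mathbf{x} = (x_1,\dotsc,x_n)$, $S = S(V) = \mathbb{C}[x_1,\dotsc,x_n]$, and $T = S(V^* ) = \mathbb{C}[\partial_1,\dotsc,\partial_n]$, the polynomial ring in the dual variables, acting on $S$ by differentiation with $\partial_i$ acting as $\partial/\partial x_i$. For a $d$-form $F \in S_d = S^d V$, the apolar ideal is $F^\perp = \{\Theta \in T : \Theta F = 0\}$, a homogeneous ideal of $T$. The projective space $\mathbb{P}V = \mathbb{P}S_1$ (points are classes $[\ell]$ of nonzero linear forms $\ell \in V$) has homogeneous coordinate ring $T$. A closed subscheme $Z \subset \mathbb{P}V$ is apolar to $F$ if its saturated homogeneous ideal $I(Z) \subset T$ satisfies $I(Z) \subseteq F^\perp$. The cactus rank $\operatorname{crk}(F)$ is the least degree of a zero-dimensional closed subscheme of $\mathbb{P}V$ apolar to $F$. For $F_i \in S^d V_i$ the same definitions are used with $V_i$ in place of $V$. *)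

theory Defs
  imports
    Complex_Main
    "HOL-Library.Poly_Mapping"
    "HOL-Library.Extended_Nat"
    "HOL-Library.Disjoint_Sets"
    "HOL-Algebra.Ideal"
begin

text \<open>
  Polynomials over the complex numbers in variables indexed by \<open>'v\<close>. For a finite
  \<open>X :: 'v set\<close> the set \<open>polys X\<close> stands both for \<open>S(V) = C[x\<^sub>v | v \<in> X]\<close> and for the
  ring \<open>T = S(V\<^sup>*) = C[\<partial>\<^sub>v | v \<in> X]\<close> of differential operators, where \<open>V\<close> has basis \<open>X\<close>;
  \<open>diff_act\<close> below says how the second acts on the first.
\<close>

type_synonym 'v cpoly = "('v \<Rightarrow>\<^sub>0 nat) \<Rightarrow>\<^sub>0 complex"

definition mono_deg :: "('v \<Rightarrow>\<^sub>0 nat) \<Rightarrow> nat" where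
  "mono_deg t = (\<Sum>v\<in>Poly_Mapping.keys t. Poly_Mapping.lookup t v)"

definition polys :: "'v set \<Rightarrow> 'v cpoly set" where
  "polys X = {F. \<forall>t\<in>Poly_Mapping.keys F. Poly_Mapping.keys t \<subseteq> X}"

definition forms :: "'v set \<Rightarrow> nat \<Rightarrow> 'v cpoly set" where
  "forms X d = {F \<in> polys X. \<forall>t\<in>Poly_Mapping.keys F. mono_deg t = d}"

definition form_component :: "nat \<Rightarrow> 'v cpoly \<Rightarrow> 'v cpoly" where
  "form_component d F = (\<Sum>t\<in>{t\<in>Poly_Mapping.keys F. mono_deg t = d}.
     Poly_Mapping.single t (Poly_Mapping.lookup F t))"

definition cscale :: "complex \<Rightarrow> 'v cpoly \<Rightarrow> 'v cpoly" where
  "cscale c F = Poly_Mapping.single 0 c * F"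

interpretation cpoly: vector_space cscale
proof
  fix a b :: complex and x y :: "'v cpoly"
  show "cscale a (x + y) = cscale a x + cscale a y"
    by (simp add: cscale_def distrib_left)
  show "cscale (a + b) x = cscale a x + cscale b x"
    by (simp add: cscale_def single_add distrib_right)
  show "cscale a (cscale b x) = cscale (a * b) x"
    by (simp add: cscale_def mult.assoc[symmetric] mult_single)
  show "cscale 1 x = x"
    by (simp add: cscale_def)
qed

subsection \<open>Differentiation\<close>

text \<open>
  \<open>\<partial>\<^sup>s x\<^sup>t = (\<Prod>v. t\<^sub>v (t\<^sub>v - 1) \<dots> (t\<^sub>v - s\<^sub>v + 1)) x\<^sup>t\<^sup>-\<^sup>s\<close>. The differences are truncated, but as
  soon as \<open>s\<^sub>v > t\<^sub>v\<close> for some \<open>v\<close>, one of the factors is zero.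
\<close>

definition diff_coeff :: "('v \<Rightarrow>\<^sub>0 nat) \<Rightarrow> ('v \<Rightarrow>\<^sub>0 nat) \<Rightarrow> nat" where
  "diff_coeff s t = (\<Prod>v\<in>Poly_Mapping.keys s. \<Prod>i<Poly_Mapping.lookup s v. Poly_Mapping.lookup t v - i)"

definition diff_act :: "'v cpoly \<Rightarrow> 'v cpoly \<Rightarrow> 'v cpoly" where
  "diff_act \<Theta> F = (\<Sum>s\<in>Poly_Mapping.keys \<Theta>. \<Sum>t\<in>Poly_Mapping.keys F.
     Poly_Mapping.single (t - s) (Poly_Mapping.lookup \<Theta> s * Poly_Mapping.lookup F t * of_nat (diff_coeff s t)))"

definition derivs :: "nat \<Rightarrow> 'v cpoly \<Rightarrow> nat \<Rightarrow> 'v cpoly set" where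
  "derivs d F a = cpoly.span {diff_act (Poly_Mapping.single s 1) F |s. mono_deg s = d - a}"

definition apolar_ideal :: "'v set \<Rightarrow> 'v cpoly \<Rightarrow> 'v cpoly set" where
  "apolar_ideal X F = {\<Theta> \<in> polys X. diff_act \<Theta> F = 0}"

subsection \<open>Closed subschemes of projective space\<close>

definition poly_ring :: "'v set \<Rightarrow> 'v cpoly ring" where
  "poly_ring X = \<lparr>carrier = polys X, mult = (*), one = 1, zero = 0, add = (+)\<rparr>"

definition homogeneous :: "'v cpoly set \<Rightarrow> bool" where
  "homogeneous I \<longleftrightarrow> (\<forall>\<Theta>\<in>I. \<forall>m. form_component m \<Theta> \<in> I)"

text \<open>
  A closed subscheme \<open>Z\<close> of \<open>P(V)\<close> is represented by its saturated homogeneous ideal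
  \<open>I(Z) \<subseteq> T\<close>; this correspondence is bijective. The ideal \<open>T\<close> itself represents the
  empty scheme.
\<close>

definition closed_subscheme :: "'v set \<Rightarrow> 'v cpoly set \<Rightarrow> bool" where
  "closed_subscheme X Z \<longleftrightarrow> ideal Z (poly_ring X) \<and> homogeneous Z \<and>
     (\<forall>\<Theta>\<in>polys X. (\<exists>N. \<forall>\<Psi>\<in>forms X N. \<Psi> * \<Theta> \<in> Z) \<longrightarrow> \<Theta> \<in> Z)"

text \<open>
  The points, closed or not, of the underlying space of \<open>Z = Proj (T / Z)\<close>: homogeneous
  primes that contain \<open>Z\<close> and do not contain the irrelevant ideal.
\<close>

definition scheme_points :: "'v set \<Rightarrow> 'v cpoly set \<Rightarrow> 'v cpoly set set" where
  "scheme_points X Z =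
     {P. primeideal P (poly_ring X) \<and> homogeneous P \<and> \<not> forms X 1 \<subseteq> P \<and> Z \<subseteq> P}"

text \<open>
  Dimension zero in the topological sense: the space is not empty, and it has no proper
  specializations, i.e. no chain of two distinct irreducible closed subsets.
\<close>

definition zero_dimensional :: "'v set \<Rightarrow> 'v cpoly set \<Rightarrow> bool" where
  "zero_dimensional X Z \<longleftrightarrow> scheme_points X Z \<noteq> {} \<and>
     (\<forall>P\<in>scheme_points X Z. \<forall>Q\<in>scheme_points X Z. P \<subseteq> Q \<longrightarrow> P = Q)"

text \<open>\<open>dim (T / Z)\<^sub>m\<close>; for finite \<open>X\<close> the space \<open>forms X m = T\<^sub>m\<close> is finite-dimensional.\<close>

definition hilbert_function :: "'v set \<Rightarrow> 'v cpoly set \<Rightarrow> nat \<Rightarrow> nat" where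
  "hilbert_function X Z m = cpoly.dim (forms X m) - cpoly.dim (Z \<inter> forms X m)"

text \<open>The degree of a zero-dimensional scheme is its (constant) Hilbert polynomial.\<close>

definition has_degree :: "'v set \<Rightarrow> 'v cpoly set \<Rightarrow> nat \<Rightarrow> bool" where
  "has_degree X Z r \<longleftrightarrow> (\<forall>\<^sub>F m in sequentially. hilbert_function X Z m = r)"

definition apolar :: "'v set \<Rightarrow> 'v cpoly set \<Rightarrow> 'v cpoly \<Rightarrow> bool" where
  "apolar X Z F \<longleftrightarrow> closed_subscheme X Z \<and> Z \<subseteq> apolar_ideal X F"

text \<open>
  The least degree, as an extended natural number: the infimum would be \<open>\<infinity>\<close> if there were
  no zero-dimensional apolar scheme, and is attained otherwise.
\<close>

definition cactus_rank :: "'v set \<Rightarrow> 'v cpoly \<Rightarrow> enat" where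
  "cactus_rank X F = Inf {enat r |r. \<exists>Z. apolar X Z F \<and> zero_dimensional X Z \<and> has_degree X Z r}"

text \<open>
  For \<open>Y \<subseteq> X\<close>, a subscheme of \<open>P(V\<^sub>Y)\<close> is a subscheme of \<open>P(V\<^sub>X)\<close>. On ideals this is the
  preimage under the restriction \<open>C[\<partial>\<^sub>v | v \<in> X] \<rightarrow> C[\<partial>\<^sub>v | v \<in> Y]\<close>, which sends \<open>\<partial>\<^sub>v\<close> to zero
  for \<open>v \<notin> Y\<close>.
\<close>

definition restrict_vars :: "'v set \<Rightarrow> 'v cpoly \<Rightarrow> 'v cpoly" where
  "restrict_vars Y \<Theta> = (\<Sum>t\<in>{t\<in>Poly_Mapping.keys \<Theta>. Poly_Mapping.keys t \<subseteq> Y}.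
     Poly_Mapping.single t (Poly_Mapping.lookup \<Theta> t))"

definition embed_subscheme :: "'v set \<Rightarrow> 'v set \<Rightarrow> 'v cpoly set \<Rightarrow> 'v cpoly set" where
  "embed_subscheme X Y Z = {\<Theta> \<in> polys X. restrict_vars Y \<Theta> \<in> Z}"

text \<open>The ideal of a union of closed subschemes is the intersection of their ideals.\<close>

definition scheme_union :: "'i set \<Rightarrow> ('i \<Rightarrow> 'v cpoly set) \<Rightarrow> 'v cpoly set" where
  "scheme_union A Z = (\<Inter>i\<in>A. Z i)"

end

theory Submission
  imports Defs
begin

text \<open>
  Why the theorem holds. Let \<open>V\<close> be the union of the sets \<open>X i\<close> and \<open>F\<close> the sum of the forms \<open>F i\<close>.

  Lower bound (\<open>dim_derivs_le_cactus_rank\<close>). If a scheme with ideal \<open>Z\<close> is apolar to \<open>F\<close>, then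
  \<open>T\<^sub>m / F\<^sup>\<bottom>\<^sub>m\<close> is a quotient of \<open>T\<^sub>m / Z\<^sub>m\<close>; for \<open>m = d - a\<close> the former is isomorphic to the space of
  derivatives of degree \<open>a\<close>. It remains to bound the Hilbert function of the saturated ideal \<open>Z\<close> by
  its eventual value (\<open>hilbert_function_le_degree\<close>), which follows from a form of large degree
  that acts injectively on \<open>T\<^sub>m / Z\<^sub>m\<close>. Such forms are found without associated primes, by linear
  algebra (\<open>ex_nonzerodivisor_on\<close>): if \<open>A\<close> has maximal rank among the maps \<open>A + \<epsilon> B\<close>, then \<open>B\<close> maps
  the kernel of \<open>A\<close> into the image of \<open>A\<close> (\<open>max_rank_kernel\<close>).

  Additivity. Derivatives of \<open>F\<close> of order between \<open>1\<close> and \<open>d - 1\<close> split into derivatives of the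
  \<open>F i\<close>, which lie in independent spaces (\<open>dim_derivs_sum\<close>), so the lower bound for \<open>F\<close> is the sum
  of the cactus ranks of the \<open>F i\<close>. It is attained by the union of minimal apolar schemes of the
  \<open>F i\<close>: this union is apolar to \<open>F\<close>, has dimension zero, and in positive degrees its Hilbert function
  is the sum of theirs (\<open>apolar_union\<close>, \<open>zero_dimensional_union\<close>, \<open>has_degree_union\<close>).

  Decomposition for \<open>2 \<le> a\<close> (\<open>apolar_decomposition\<close>). For an apolar scheme of minimal degree all
  inequalities of the lower bound are equalities. As the spaces of derivatives of degrees \<open>a\<close> and
  \<open>d - a\<close> have the same dimension (\<open>dim_derivs_symmetric_le\<close>), the ideal \<open>Z\<close> agrees with \<open>F\<^sup>\<bottom>\<close> in
  degree \<open>a\<close>. There \<open>F\<^sup>\<bottom>\<close> contains every monomial with variables from two different \<open>X i\<close>, so by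
  saturation \<open>Z\<close> contains all products of two such variables. Modulo these products an element
  of \<open>Z\<close> is the sum of its restrictions to the \<open>X i\<close>, which lie in \<open>Z\<close> by saturation once more; hence
  \<open>Z\<close> is determined by its intersections with the smaller polynomial rings, and these are the ideals
  of the wanted schemes.
\<close>

section \<open>Linear algebra\<close>

context vector_space
begin

text \<open>The set \<open>V\<close> lies in a subspace with a finite spanning set. In an infinite-dimensional
  space the function \<open>dim\<close> behaves as expected only on such sets, because \<open>card\<close> is zero on
  infinite bases.\<close>

definition fin_dim :: "'b set \<Rightarrow> bool" where
  "fin_dim V \<longleftrightarrow> (\<exists>S. finite S \<and> V \<subseteq> span S)"

lemma fin_dim_subset: "local.fin_dim W \<Longrightarrow> V \<subseteq> W \<Longrightarrow> local.fin_dim V"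
  unfolding local.fin_dim_def by blast

lemma independent_finite_card_le_dim:
  assumes "independent B" "B \<subseteq> V" "local.fin_dim V"
  shows "finite B \<and> card B \<le> dim V"
proof -
  obtain S where S: "finite S" "V \<subseteq> span S"
    using assms(3) unfolding local.fin_dim_def by blast
  obtain C where C: "C \<subseteq> V" "independent C" "V \<subseteq> span C" "card C = dim V"
    using basis_exists by blast
  have "finite C" using independent_span_bound[OF S(1) C(2)] C(1) S(2) by blast
  then show ?thesis
    using independent_span_bound[of C B] assms C by auto
qed

lemma fin_dim_basis:
  assumes "subspace V" "local.fin_dim V"
  obtains B where "finite B" "independent B" "span B = V" "card B = dim V"
proof -
  obtain B where B: "B \<subseteq> V" "independent B" "V \<subseteq> span B" "card B = dim V"
    using basis_exists by blast
  moreover have "finite B" using local.independent_finite_card_le_dim[OF B(2,1) assms(2)] by simp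
  ultimately show ?thesis using that span_minimal[OF B(1) assms(1)] by blast
qed

lemma dim_mono_fin_dim:
  assumes "V \<subseteq> W" "local.fin_dim W"
  shows "dim V \<le> dim W"
proof -
  obtain B where B: "B \<subseteq> V" "independent B" "V \<subseteq> span B" "card B = dim V"
    using basis_exists by blast
  then show ?thesis
    using local.independent_finite_card_le_dim[of B W] assms by auto
qed

lemma subspace_eq_if_dim_le:
  assumes "subspace V" "V \<subseteq> W" "local.fin_dim W" "dim W \<le> dim V"
  shows "V = W"
proof (rule ccontr)
  assume "V \<noteq> W"
  then obtain w where w: "w \<in> W" "w \<notin> V" using assms(2) by blast
  obtain B where B: "finite B" "independent B" "span B = V" "card B = dim V"
    by (rule local.fin_dim_basis[OF assms(1) local.fin_dim_subset[OF assms(3,2)]]) (rule that)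
  have "independent (insert w B)" using w B by (simp add: independent_insertI)
  moreover have "insert w B \<subseteq> W" using w B(3) assms(2) span_superset by blast
  ultimately have "card (insert w B) \<le> dim W"
    using local.independent_finite_card_le_dim assms(3) by blast
  moreover have "w \<notin> B" using w B(3) span_superset by blast
  ultimately show False using B assms(4) by simp
qed

lemma independent_familyI:
  assumes "finite E"
    and "\<And>c e. (\<Sum>e\<in>E. scale (c e) (p e)) = 0 \<Longrightarrow> e \<in> E \<Longrightarrow> c e = 0"
  shows "inj_on p E \<and> independent (p ` E)"
proof -
  have inj: "inj_on p E"
  proof (rule inj_onI, rule ccontr)
    fix x y assume xy: "x \<in> E" "y \<in> E" "p x = p y" "x \<noteq> y"
    define c :: "'c \<Rightarrow> 'a" where "c e = (if e = x then 1 else if e = y then - 1 else 0)" for e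
    have "(\<Sum>e\<in>E. scale (c e) (p e)) = (\<Sum>e\<in>{x, y}. scale (c e) (p e))"
      by (rule sum.mono_neutral_right) (use assms(1) xy in \<open>auto simp: c_def\<close>)
    also have "\<dots> = 0" using xy by (simp add: c_def)
    finally have "c x = 0" using assms(2) xy(1) by blast
    then show False by (simp add: c_def)
  qed
  moreover have "independent (p ` E)"
  proof (rule independent_if_scalars_zero)
    fix f x assume f: "(\<Sum>x\<in>p ` E. scale (f x) x) = 0" and "x \<in> p ` E"
    then obtain e where e: "e \<in> E" "x = p e" by blast
    have "(\<Sum>e\<in>E. scale (f (p e)) (p e)) = 0"
      using f by (simp add: sum.reindex[OF inj])
    from assms(2)[of "\<lambda>e. f (p e)", OF this e(1)] show "f x = 0" using e by simp
  qed (use assms in simp)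
  ultimately show ?thesis ..
qed

lemma independent_Int_span:
  assumes "independent (B \<union> C)" "B \<inter> C = {}" "x \<in> span B" "x \<in> span C"
  shows "x = 0"
proof -
  have "representation (B \<union> C) x = representation B x" "representation (B \<union> C) x = representation C x"
    by (rule representation_extend; use assms in auto)+
  then have "representation B x v = 0" for v
    using representation_ne_zero[of B x v] representation_ne_zero[of C x v] assms(2) by auto
  then show ?thesis
    using sum_nonzero_representation_eq[of B x] assms independent_mono[of "B \<union> C" B] by auto
qed

end

context vector_space_pair
begin

lemma fin_dim_image:
  assumes "Vector_Spaces.linear s1 s2 f" "vs1.fin_dim V"
  shows "vs2.fin_dim (f ` V)"
proof -
  obtain S where "finite S" "V \<subseteq> vs1.span S"
    using assms(2) unfolding vs1.fin_dim_def by blast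
  then have "f ` V \<subseteq> vs2.span (f ` S)" "finite (f ` S)"
    using linear_span_image[OF assms(1)] by auto
  then show ?thesis unfolding vs2.fin_dim_def by blast
qed

lemma dim_kernel_plus_image:
  assumes lin: "Vector_Spaces.linear s1 s2 f" and V: "vs1.subspace V" "vs1.fin_dim V"
  shows "vs1.dim V = vs1.dim {x \<in> V. f x = 0} + vs2.dim (f ` V)"
proof -
  let ?K = "{x \<in> V. f x = 0}"
  have "?K = V \<inter> {x. f x = 0}" by blast
  then have K: "vs1.subspace ?K"
    using vs1.subspace_inter[OF V(1) linear_subspace_kernel[OF lin]] by simp
  obtain B where B: "finite B" "vs1.independent B" "vs1.span B = ?K" "card B = vs1.dim ?K"
    by (rule vs1.fin_dim_basis[OF K vs1.fin_dim_subset[OF V(2)]]) (auto intro: that)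
  have "B \<subseteq> V" using B(3) vs1.span_superset by blast
  then obtain C where C: "B \<subseteq> C" "C \<subseteq> V" "vs1.independent C" "V \<subseteq> vs1.span C"
    using vs1.maximal_independent_subset_extend B(2) by blast
  have finC: "finite C" using vs1.independent_finite_card_le_dim[OF C(3,2) V(2)] by simp
  have spanC: "vs1.span C = V" using C vs1.span_minimal[OF C(2) V(1)] by blast
  have indD: "vs1.independent (C - B)" using C(3) vs1.independent_mono by blast
  have inj: "inj_on f (vs1.span (C - B))"
    unfolding linear_inj_on_iff_eq_0[OF lin vs1.subspace_span]
  proof (intro ballI impI)
    fix x assume x: "x \<in> vs1.span (C - B)" "f x = 0"
    then have "x \<in> V" using vs1.span_mono[of "C - B" C] spanC by blast
    then have "x \<in> vs1.span B" using B(3) x by blast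
    moreover have "vs1.independent (B \<union> (C - B))" using C(1,3) by (simp add: Un_absorb1)
    ultimately show "x = 0" using vs1.independent_Int_span[of B "C - B" x] x by blast
  qed
  have ind: "vs2.independent (f ` (C - B))"
    using linear_independent_injective_image[OF lin indD inj] .
  have "f ` V \<subseteq> vs2.span (f ` (C - B))"
  proof -
    have "f ` C \<subseteq> insert 0 (f ` (C - B))" using B(3) vs1.span_superset by blast
    then have "vs2.span (f ` C) \<subseteq> vs2.span (insert 0 (f ` (C - B)))" by (rule vs2.span_mono)
    then show ?thesis using spanC linear_span_image[OF lin, of C] by simp
  qed
  moreover have "f ` (C - B) \<subseteq> f ` V" using C(2) by blast
  moreover have "card (f ` (C - B)) = card (C - B)"
    using inj inj_on_subset[OF inj vs1.span_superset] by (simp add: card_image)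
  ultimately have "vs2.dim (f ` V) = card (C - B)"
    using ind vs2.basis_card_eq_dim by metis
  moreover have "vs1.dim V = card C"
    using vs1.basis_card_eq_dim[OF C(2,4,3)] by simp
  moreover have "card C = card B + card (C - B)"
    using card_Diff_subset[OF B(1) C(1)] card_mono[OF finC C(1)] by simp
  ultimately show ?thesis using B(4) by simp
qed

end

interpretation cpoly_pair: vector_space_pair "cscale :: complex \<Rightarrow> 'v cpoly \<Rightarrow> 'v cpoly"
  "cscale :: complex \<Rightarrow> 'v cpoly \<Rightarrow> 'v cpoly" ..

text \<open>Complex linear endomorphisms of the space of polynomials.\<close>

abbreviation clinear :: "('v cpoly \<Rightarrow> 'v cpoly) \<Rightarrow> bool" where
  "clinear \<equiv> Vector_Spaces.linear cscale cscale"

lemma clinearI: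
  assumes "\<And>x y. f (x + y) = f x + f y" "\<And>c x. f (cscale c x) = cscale c (f x)"
  shows "clinear f"
  unfolding Vector_Spaces.linear_iff using assms cpoly.vector_space_axioms by blast

text \<open>Every subspace is the kernel of a linear map, so that working modulo the subspace amounts
  to applying this map.\<close>

lemma subspace_is_kernel:
  assumes "cpoly.subspace W"
  obtains q where "clinear q" "\<And>x. q x = 0 \<longleftrightarrow> x \<in> W"
proof -
  obtain B where B: "B \<subseteq> W" "cpoly.independent B" "W \<subseteq> cpoly.span B"
    using cpoly.maximal_independent_subset by blast
  then have spanB: "cpoly.span B = W" using cpoly.span_minimal[OF B(1) assms] by blast
  define C where "C = cpoly.extend_basis B"
  have C: "B \<subseteq> C" "cpoly.independent C" "cpoly.span C = UNIV"
    unfolding C_def using B(2) cpoly.extend_basis_superset cpoly.independent_extend_basis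
      cpoly.span_extend_basis by blast+
  define D where "D = C - B"
  have CD: "C = D \<union> B" "D \<inter> B = {}" using C(1) unfolding D_def by auto
  have indD: "cpoly.independent D" using cpoly.independent_mono[OF C(2)] CD by blast
  obtain q where lin: "clinear q" and q: "\<And>x. x \<in> C \<Longrightarrow> q x = (if x \<in> B then 0 else x)"
    using cpoly_pair.linear_independent_extend[OF C(2), of "\<lambda>x. if x \<in> B then 0 else x"] by auto
  have q0: "q x = 0" if "x \<in> cpoly.span B" for x
  proof (rule cpoly_pair.linear_eq_0_on_span[OF lin _ that])
    fix b assume "b \<in> B"
    then show "q b = 0" using q[of b] C(1) by auto
  qed
  have "clinear (\<lambda>x. x)" by (rule clinearI) simp_all
  then have qid: "q x = x" if "x \<in> cpoly.span D" for x
  proof (rule cpoly_pair.linear_eq_on[OF lin _ that])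
    fix b assume "b \<in> D"
    then show "q b = b" using q[of b] CD by auto
  qed
  have "q x = 0 \<longleftrightarrow> x \<in> W" for x
  proof
    assume qx: "q x = 0"
    have "x \<in> cpoly.span (D \<union> B)" using C(3) CD by simp
    then obtain u v where uv: "x = u + v" "u \<in> cpoly.span D" "v \<in> cpoly.span B"
      unfolding cpoly.span_Un by auto
    then have "q x = u" using q0 qid cpoly_pair.linear_add[OF lin] by simp
    then show "x \<in> W" using qx uv spanB by simp
  qed (use q0 spanB in simp)
  then show ?thesis using that lin by blast
qed

text \<open>Linear independence is an open condition. Expressed in the coordinates with respect to
  \<open>E\<close>, the matrix of the perturbed family is close to the identity, hence invertible.\<close>

lemma independent_perturbation:
  fixes w :: "'v cpoly \<Rightarrow> 'v cpoly"
  assumes "finite E" "cpoly.independent E"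
  obtains \<epsilon> :: complex where "\<epsilon> \<noteq> 0"
    "\<And>c e. (\<Sum>e\<in>E. cscale (c e) (e + cscale \<epsilon> (w e))) = 0 \<Longrightarrow> e \<in> E \<Longrightarrow> c e = 0"
proof -
  define B where "B = cpoly.extend_basis E"
  have B: "E \<subseteq> B" "cpoly.independent B" "cpoly.span B = UNIV"
    unfolding B_def using assms(2) cpoly.extend_basis_superset cpoly.independent_extend_basis
      cpoly.span_extend_basis by blast+
  define f where "f e x = cpoly.representation B x e" for e x
  have f_sum: "f e (\<Sum>i\<in>I. x i) = (\<Sum>i\<in>I. f e (x i))" for e x and I :: "'v cpoly set"
    unfolding f_def by (simp add: cpoly.representation_sum[OF B(2)] B(3))
  have f_add: "f e (x + y) = f e x + f e y" for e x y
    unfolding f_def using cpoly.representation_add[OF B(2)] B(3) by simp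
  have f_scale: "f e (cscale c x) = c * f e x" for e x c
    unfolding f_def using cpoly.representation_scale[OF B(2)] B(3) by simp
  have f_basis: "f e e' = (if e = e' then 1 else 0)" if "e' \<in> E" for e e'
    unfolding f_def using cpoly.representation_basis[OF B(2)] that B(1) by auto
  define M where "M = (\<Sum>e\<in>E. \<Sum>e'\<in>E. norm (f e (w e'))) + 1"
  have M1: "M \<ge> 1" unfolding M_def by (simp add: sum_nonneg)
  define \<epsilon> where "\<epsilon> = complex_of_real (1 / (2 * M))"
  have "\<epsilon> \<noteq> 0" using M1 unfolding \<epsilon>_def by simp
  moreover have "c e = 0" if zero: "(\<Sum>e\<in>E. cscale (c e) (e + cscale \<epsilon> (w e))) = 0" and e: "e \<in> E" for c e
  proof -
    have eq: "c j = - (\<epsilon> * (\<Sum>i\<in>E. c i * f j (w i)))" if j: "j \<in> E" for j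
    proof -
      have "0 = f j (\<Sum>e\<in>E. cscale (c e) (e + cscale \<epsilon> (w e)))"
        unfolding zero f_def by (simp add: cpoly.representation_zero)
      also have "\<dots> = (\<Sum>i\<in>E. c i * f j i + \<epsilon> * (c i * f j (w i)))"
        by (simp add: f_sum f_add f_scale algebra_simps)
      also have "\<dots> = (\<Sum>i\<in>E. if j = i then c i else 0) + \<epsilon> * (\<Sum>i\<in>E. c i * f j (w i))"
        unfolding sum.distrib sum_distrib_left by (rule arg_cong2[of _ _ _ _ "(+)"]; rule sum.cong)
          (auto simp: f_basis)
      also have "\<dots> = c j + \<epsilon> * (\<Sum>i\<in>E. c i * f j (w i))"
        using j assms(1) by simp
      finally show ?thesis by (simp add: eq_neg_iff_add_eq_0)
    qed
    define m where "m = Max ((\<lambda>i. norm (c i)) ` E)"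
    have mle: "norm (c i) \<le> m" if "i \<in> E" for i
      unfolding m_def using that assms(1) by simp
    have "m \<in> (\<lambda>i. norm (c i)) ` E" unfolding m_def using e assms(1) by (intro Max_in) auto
    then obtain j where j: "j \<in> E" "m = norm (c j)" by blast
    have m0: "m \<ge> 0" using j by simp
    have "m = norm \<epsilon> * norm (\<Sum>i\<in>E. c i * f j (w i))"
      using arg_cong[OF eq[OF j(1)], of norm] unfolding j(2) by (simp add: norm_mult)
    also have "\<dots> \<le> norm \<epsilon> * (\<Sum>i\<in>E. m * norm (f j (w i)))"
      by (intro mult_left_mono sum_norm_le) (auto simp: norm_mult intro!: mult_right_mono mle)
    also have "(\<Sum>i\<in>E. m * norm (f j (w i))) = m * (\<Sum>i\<in>E. norm (f j (w i)))"
      by (simp add: sum_distrib_left)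
    also have "(\<Sum>i\<in>E. norm (f j (w i))) \<le> M"
    proof -
      have "(\<Sum>i\<in>E. norm (f j (w i))) \<le> (\<Sum>e\<in>E. \<Sum>i\<in>E. norm (f e (w i)))"
        using j assms(1) by (intro member_le_sum[of j E "\<lambda>e. \<Sum>i\<in>E. norm (f e (w i))"]) (auto intro: sum_nonneg)
      then show ?thesis unfolding M_def by simp
    qed
    then have "norm \<epsilon> * (m * (\<Sum>i\<in>E. norm (f j (w i)))) \<le> norm \<epsilon> * (m * M)"
      using m0 by (intro mult_left_mono) auto
    also have "norm \<epsilon> * (m * M) = m / 2" using M1 unfolding \<epsilon>_def by (simp add: norm_divide)
    finally have "norm (c e) = 0" using mle[OF e] norm_ge_zero[of "c e"] by linarith
    then show "c e = 0" by simp
  qed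
  ultimately show ?thesis using that by blast
qed

text \<open>If \<open>A\<close> has maximal rank on the line \<open>A + \<epsilon> B\<close> of linear maps, then \<open>B\<close> maps the kernel
  of \<open>A\<close> into the image of \<open>A\<close>. Otherwise a basis of the image of \<open>A\<close> together with \<open>B u\<close>
  could be perturbed into the image of some \<open>A + \<epsilon> B\<close>.\<close>

lemma max_rank_kernel:
  assumes lin: "clinear A" "clinear B" and V: "cpoly.subspace V" "cpoly.fin_dim V"
    and max: "\<And>\<epsilon>. cpoly.dim ((\<lambda>x. A x + cscale \<epsilon> (B x)) ` V) \<le> cpoly.dim (A ` V)"
    and u: "u \<in> V" "A u = 0"
  shows "B u \<in> A ` V"
proof (rule ccontr)
  assume nin: "B u \<notin> A ` V"
  have sub: "cpoly.subspace (A ` V)" using cpoly_pair.linear_subspace_image[OF lin(1) V(1)] .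
  obtain E where E: "finite E" "cpoly.independent E" "cpoly.span E = A ` V" "card E = cpoly.dim (A ` V)"
    by (rule cpoly.fin_dim_basis[OF sub cpoly_pair.fin_dim_image[OF lin(1) V(2)]]) (rule that)
  have E_sub: "E \<subseteq> A ` V" using cpoly.span_superset[of E] E(3) by simp
  then have "\<forall>e\<in>E. \<exists>x\<in>V. A x = e" by fastforce
  then obtain g where g: "\<And>e. e \<in> E \<Longrightarrow> g e \<in> V" "\<And>e. e \<in> E \<Longrightarrow> A (g e) = e" by metis
  define E' where "E' = insert (B u) E"
  have BuE: "B u \<notin> E" using nin E_sub by blast
  have E': "finite E'" "cpoly.independent E'"
    unfolding E'_def using E nin cpoly.independent_insertI[of "B u" E] by simp_all
  define w where "w e = (if e = B u then 0 else B (g e))" for e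
  obtain \<epsilon> where \<epsilon>: "\<epsilon> \<noteq> 0"
    "\<And>c e. (\<Sum>e\<in>E'. cscale (c e) (e + cscale \<epsilon> (w e))) = 0 \<Longrightarrow> e \<in> E' \<Longrightarrow> c e = 0"
    using independent_perturbation[OF E', of w] by blast
  define p where "p e = e + cscale \<epsilon> (w e)" for e
  have ind: "inj_on p E' \<and> cpoly.independent (p ` E')"
    using cpoly.independent_familyI[OF E'(1), of p] \<epsilon>(2) unfolding p_def by blast
  let ?L = "\<lambda>x. A x + cscale \<epsilon> (B x)"
  have linL: "clinear ?L"
    by (rule clinearI) (simp_all add: cpoly_pair.linear_add[OF lin(1)] cpoly_pair.linear_add[OF lin(2)]
      cpoly_pair.linear_scale[OF lin(1)] cpoly_pair.linear_scale[OF lin(2)] cpoly.scale_right_distrib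
      mult.commute)
  (* B u itself is in the image of A + \<epsilon> B, as the value at u / \<epsilon>. *)
  have img: "p ` E' \<subseteq> ?L ` V"
  proof
    fix x assume "x \<in> p ` E'"
    then obtain e where e: "e \<in> E'" "x = p e" by blast
    show "x \<in> ?L ` V"
    proof (cases "e = B u")
      case True
      have "x = B u" using e True by (simp add: p_def w_def)
      also have "\<dots> = ?L (cscale (1 / \<epsilon>) u)"
        using u(2) \<epsilon>(1) by (simp add: cpoly_pair.linear_scale[OF lin(1)] cpoly_pair.linear_scale[OF lin(2)])
      finally show ?thesis by (rule image_eqI) (use u(1) V(1) cpoly.subspace_scale in blast)
    next
      case False
      then have "e \<in> E" using e by (simp add: E'_def)
      then have "x = ?L (g e)" "g e \<in> V" using g e False by (auto simp: p_def w_def)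
      then show ?thesis by (rule image_eqI)
    qed
  qed
  have "card (p ` E') \<le> cpoly.dim (?L ` V)"
    using cpoly.independent_finite_card_le_dim[OF _ img cpoly_pair.fin_dim_image[OF linL V(2)]] ind by blast
  moreover have "card (p ` E') = card E + 1"
    using ind E(1) BuE by (simp add: card_image E'_def)
  ultimately show False using max[of \<epsilon>] E(4) by simp
qed

text \<open>The dimension of a direct sum. That the sum is direct is witnessed by projections.\<close>

lemma dim_direct_sum:
  assumes "finite A"
    and W: "\<And>i. i \<in> A \<Longrightarrow> cpoly.subspace (W i)" "\<And>i. i \<in> A \<Longrightarrow> cpoly.fin_dim (W i)"
    and p: "\<And>i. i \<in> A \<Longrightarrow> clinear (p i)" "\<And>i w. i \<in> A \<Longrightarrow> w \<in> W i \<Longrightarrow> p i w = w"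
      "\<And>i j w. i \<in> A \<Longrightarrow> j \<in> A \<Longrightarrow> i \<noteq> j \<Longrightarrow> w \<in> W j \<Longrightarrow> p i w = 0"
  shows "cpoly.subspace {\<Sum>i\<in>A. w i |w. \<forall>i\<in>A. w i \<in> W i} \<and>
    cpoly.fin_dim {\<Sum>i\<in>A. w i |w. \<forall>i\<in>A. w i \<in> W i} \<and>
    cpoly.dim {\<Sum>i\<in>A. w i |w. \<forall>i\<in>A. w i \<in> W i} = (\<Sum>i\<in>A. cpoly.dim (W i))"
  using assms
proof (induction A rule: finite_induct)
  case empty
  have "cpoly.fin_dim {0}" unfolding cpoly.fin_dim_def using cpoly.span_zero by blast
  moreover have "cpoly.dim {0} = 0"
    using cpoly.dim_le_card[of "{0}" "{}"] by simp
  ultimately show ?case by (simp add: cpoly.subspace_single_0)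
next
  case (insert j A)
  define S where "S A = {\<Sum>i\<in>A. w i |w. \<forall>i\<in>A. w i \<in> W i}" for A
  have IH: "cpoly.subspace (S A)" "cpoly.fin_dim (S A)" "cpoly.dim (S A) = (\<Sum>i\<in>A. cpoly.dim (W i))"
  proof -
    have "cpoly.subspace (S A) \<and> cpoly.fin_dim (S A) \<and> cpoly.dim (S A) = (\<Sum>i\<in>A. cpoly.dim (W i))"
      unfolding S_def by (rule insert.IH; rule insert.prems; simp)
    then show "cpoly.subspace (S A)" "cpoly.fin_dim (S A)"
      "cpoly.dim (S A) = (\<Sum>i\<in>A. cpoly.dim (W i))" by blast+
  qed
  have Wj: "cpoly.subspace (W j)" "cpoly.fin_dim (W j)" using insert.prems by auto
  have S_eq: "S (insert j A) = {x + y |x y. x \<in> W j \<and> y \<in> S A}"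
  proof (intro equalityI subsetI)
    fix x assume "x \<in> S (insert j A)"
    then obtain w where w: "\<forall>i\<in>insert j A. w i \<in> W i" "x = (\<Sum>i\<in>insert j A. w i)"
      unfolding S_def by blast
    moreover have "(\<Sum>i\<in>A. w i) \<in> S A" unfolding S_def using w by blast
    ultimately show "x \<in> {x + y |x y. x \<in> W j \<and> y \<in> S A}"
      using insert.hyps by auto
  next
    fix x assume "x \<in> {x + y |x y. x \<in> W j \<and> y \<in> S A}"
    then obtain v w where vw: "v \<in> W j" "\<forall>i\<in>A. w i \<in> W i" "x = v + (\<Sum>i\<in>A. w i)"
      unfolding S_def by blast
    have "(\<Sum>i\<in>A. (w(j := v)) i) = (\<Sum>i\<in>A. w i)"
      using insert.hyps by (intro sum.cong) auto
    then have "x = (\<Sum>i\<in>insert j A. (w(j := v)) i)"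
      using insert.hyps vw by simp
    moreover have "\<forall>i\<in>insert j A. (w(j := v)) i \<in> W i" using vw by auto
    ultimately show "x \<in> S (insert j A)" unfolding S_def by blast
  qed
  have sub: "cpoly.subspace (S (insert j A))"
    unfolding S_eq using cpoly.subspace_sums[OF Wj(1) IH(1)] .
  have fin: "cpoly.fin_dim (S (insert j A))"
  proof -
    obtain R where R: "finite R" "W j \<subseteq> cpoly.span R"
      using Wj(2) unfolding cpoly.fin_dim_def by (elim exE conjE)
    obtain T where T: "finite T" "S A \<subseteq> cpoly.span T"
      using IH(2) unfolding cpoly.fin_dim_def by (elim exE conjE)
    from R T have "S (insert j A) \<subseteq> cpoly.span (R \<union> T)" "finite (R \<union> T)"
      unfolding S_eq cpoly.span_Un by blast+
    then show ?thesis unfolding cpoly.fin_dim_def by blast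
  qed
  have lin: "clinear (p j)" using insert.prems by simp
  have pA: "p j y = 0" if y: "y \<in> S A" for y
  proof -
    obtain w where w: "\<forall>i\<in>A. w i \<in> W i" "y = (\<Sum>i\<in>A. w i)" using y unfolding S_def by blast
    then have "p j y = (\<Sum>i\<in>A. p j (w i))" using cpoly_pair.linear_sum[OF lin] by simp
    also have "\<dots> = 0"
    proof (rule sum.neutral, intro ballI)
      fix x assume "x \<in> A"
      then show "p j (w x) = 0" using insert.prems(5)[of j x "w x"] w(1) insert.hyps by auto
    qed
    finally show ?thesis .
  qed
  have pxy: "p j (x + y) = x" if "x \<in> W j" "y \<in> S A" for x y
    using that pA[of y] insert.prems(4)[of j x] cpoly_pair.linear_add[OF lin, of x y] by simp
  have zero: "0 \<in> W j" "0 \<in> S A" using Wj(1) IH(1) cpoly.subspace_0 by blast+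
  have "p j ` S (insert j A) = W j"
  proof
    show "p j ` S (insert j A) \<subseteq> W j" unfolding S_eq using pxy by auto
    show "W j \<subseteq> p j ` S (insert j A)"
    proof
      fix x assume "x \<in> W j"
      then have "x = p j (x + 0)" "x + 0 \<in> S (insert j A)"
        unfolding S_eq using pxy[of x 0] zero by (simp, blast)
      then show "x \<in> p j ` S (insert j A)" by (rule image_eqI)
    qed
  qed
  moreover have "{x \<in> S (insert j A). p j x = 0} = S A"
  proof
    show "{x \<in> S (insert j A). p j x = 0} \<subseteq> S A" unfolding S_eq using pxy by auto
    show "S A \<subseteq> {x \<in> S (insert j A). p j x = 0}"
    proof
      fix y assume y: "y \<in> S A"
      then have "0 + y \<in> S (insert j A)" unfolding S_eq using zero by blast
      then show "y \<in> {x \<in> S (insert j A). p j x = 0}" using pA[OF y] by simp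
    qed
  qed
  ultimately have "cpoly.dim (S (insert j A)) = cpoly.dim (S A) + cpoly.dim (W j)"
    using cpoly_pair.dim_kernel_plus_image[OF lin sub fin] by simp
  then show ?case using sub fin IH(3) insert.hyps unfolding S_def by simp
qed

section \<open>Monomials and forms\<close>

lemma keys_add_nat: "Poly_Mapping.keys (s + t) = Poly_Mapping.keys s \<union> Poly_Mapping.keys (t :: 'v \<Rightarrow>\<^sub>0 nat)"
  by (auto simp: in_keys_iff lookup_add)

lemma mono_deg_superset:
  "finite A \<Longrightarrow> Poly_Mapping.keys t \<subseteq> A \<Longrightarrow> mono_deg t = (\<Sum>v\<in>A. Poly_Mapping.lookup t v)"
  unfolding mono_deg_def by (rule sum.mono_neutral_left) (auto simp: in_keys_iff)

lemma mono_deg_add: "mono_deg (s + t) = mono_deg s + mono_deg t"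
proof -
  let ?A = "Poly_Mapping.keys s \<union> Poly_Mapping.keys t"
  have "mono_deg (s + t) = (\<Sum>v\<in>?A. Poly_Mapping.lookup (s + t) v)"
    "mono_deg s = (\<Sum>v\<in>?A. Poly_Mapping.lookup s v)" "mono_deg t = (\<Sum>v\<in>?A. Poly_Mapping.lookup t v)"
    by (rule mono_deg_superset; simp add: keys_add_nat)+
  then show ?thesis by (simp add: lookup_add sum.distrib)
qed

lemma mono_deg_zero [simp]: "mono_deg 0 = 0"
  by (simp add: mono_deg_def)

lemma mono_deg_eq_0_iff: "mono_deg t = 0 \<longleftrightarrow> t = 0"
proof
  assume "mono_deg t = 0"
  then have "Poly_Mapping.lookup t v = 0" for v
    unfolding mono_deg_def by (cases "v \<in> Poly_Mapping.keys t") (auto simp: in_keys_iff)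
  then show "t = 0" by (intro poly_mapping_eqI) simp
qed simp

lemma mono_deg_single [simp]: "mono_deg (Poly_Mapping.single v n) = n"
  by (simp add: mono_deg_def)

lemma lookup_le_mono_deg: "Poly_Mapping.lookup t v \<le> mono_deg t"
  unfolding mono_deg_def
  by (cases "v \<in> Poly_Mapping.keys t") (auto simp: in_keys_iff intro: member_le_sum)

lemma finite_monomials:
  assumes "finite X"
  shows "finite {t. Poly_Mapping.keys t \<subseteq> X \<and> mono_deg t = m}"
proof -
  let ?M = "{t. Poly_Mapping.keys t \<subseteq> X \<and> mono_deg t = m}"
  have "Poly_Mapping.lookup ` ?M \<subseteq> {f. \<forall>x. (x \<in> X \<longrightarrow> f x \<in> {..m}) \<and> (x \<notin> X \<longrightarrow> f x = 0)}"
    using lookup_le_mono_deg by (fastforce simp: in_keys_iff)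
  moreover have "finite {f. \<forall>x. (x \<in> X \<longrightarrow> f x \<in> {..m}) \<and> (x \<notin> X \<longrightarrow> f x = (0::nat))}"
    using assms by (intro finite_set_of_finite_funs) auto
  ultimately have "finite (Poly_Mapping.lookup ` ?M)" by (rule finite_subset)
  then show ?thesis
    by (rule finite_imageD) (simp add: inj_on_def poly_mapping.lookup_inject)
qed

text \<open>The monomial with exponents \<open>t\<close> as a polynomial with coefficient \<open>1\<close>.\<close>

abbreviation monom_poly :: "('v \<Rightarrow>\<^sub>0 nat) \<Rightarrow> 'v cpoly" where
  "monom_poly t \<equiv> Poly_Mapping.single t 1"

lemma lookup_cscale [simp]: "Poly_Mapping.lookup (cscale c F) t = c * Poly_Mapping.lookup F t"
  unfolding cscale_def mult_map_scale_conv_mult[symmetric] by (simp add: Poly_Mapping.map.rep_eq when_def)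

lemma cscale_single: "cscale c (Poly_Mapping.single t b) = Poly_Mapping.single t (c * b)"
  by (simp add: cscale_def mult_single)

lemma monomial_expansion: "F = (\<Sum>t\<in>Poly_Mapping.keys F. cscale (Poly_Mapping.lookup F t) (monom_poly t))"
proof (rule poly_mapping_eqI)
  fix k
  have "Poly_Mapping.lookup (\<Sum>t\<in>Poly_Mapping.keys F. cscale (Poly_Mapping.lookup F t) (monom_poly t)) k =
    (\<Sum>t\<in>Poly_Mapping.keys F. if t = k then Poly_Mapping.lookup F t else 0)"
    unfolding lookup_sum by (rule sum.cong) (simp_all add: lookup_single when_def)
  then show "Poly_Mapping.lookup F k =
    Poly_Mapping.lookup (\<Sum>t\<in>Poly_Mapping.keys F. cscale (Poly_Mapping.lookup F t) (monom_poly t)) k"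
    by (simp add: in_keys_iff)
qed

text \<open>The expansion into monomials reduces identities between linear maps to monomials.\<close>

lemma clinear_eqI:
  assumes f: "clinear f" and g: "clinear g"
    and eq: "\<And>t. t \<in> Poly_Mapping.keys F \<Longrightarrow> f (monom_poly t) = g (monom_poly t)"
  shows "f F = g F"
proof -
  have "f F = f (\<Sum>t\<in>Poly_Mapping.keys F. cscale (Poly_Mapping.lookup F t) (monom_poly t))"
    using monomial_expansion[of F] by simp
  also have "\<dots> = (\<Sum>t\<in>Poly_Mapping.keys F. cscale (Poly_Mapping.lookup F t) (f (monom_poly t)))"
    by (simp add: cpoly_pair.linear_sum[OF f] cpoly_pair.linear_scale[OF f])
  also have "\<dots> = (\<Sum>t\<in>Poly_Mapping.keys F. cscale (Poly_Mapping.lookup F t) (g (monom_poly t)))"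
    by (rule sum.cong) (use eq in auto)
  also have "\<dots> = g (\<Sum>t\<in>Poly_Mapping.keys F. cscale (Poly_Mapping.lookup F t) (monom_poly t))"
    by (simp add: cpoly_pair.linear_sum[OF g] cpoly_pair.linear_scale[OF g])
  also have "\<dots> = g F" using monomial_expansion[of F] by simp
  finally show ?thesis .
qed

lemma clinear_in_subspace:
  assumes f: "clinear f" and W: "cpoly.subspace W"
    and mem: "\<And>t. t \<in> Poly_Mapping.keys F \<Longrightarrow> f (monom_poly t) \<in> W"
  shows "f F \<in> W"
proof -
  have "f F = (\<Sum>t\<in>Poly_Mapping.keys F. cscale (Poly_Mapping.lookup F t) (f (monom_poly t)))"
    using arg_cong[OF monomial_expansion[of F], of f]
    by (simp add: cpoly_pair.linear_sum[OF f] cpoly_pair.linear_scale[OF f])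
  also have "\<dots> \<in> W" by (intro cpoly.subspace_sum[OF W] cpoly.subspace_scale[OF W] mem)
  finally show ?thesis .
qed

lemma clinear_id: "clinear (\<lambda>x. x)"
  by (rule clinearI) simp_all

lemma clinear_compose: "clinear f \<Longrightarrow> clinear g \<Longrightarrow> clinear (\<lambda>x. g (f x))"
  by (rule clinearI)
    (simp_all add: cpoly_pair.linear_add cpoly_pair.linear_scale)

lemma clinear_mult_left: "clinear (\<lambda>x. g * x)"
  by (rule clinearI) (simp_all add: distrib_left cscale_def mult.left_commute)

lemma clinear_mult_right: "clinear (\<lambda>x. x * g)"
  by (rule clinearI) (simp_all add: distrib_right cscale_def mult.assoc)

lemma cscale_mult_left: "cscale c (F * G) = cscale c F * G"
  by (simp add: cscale_def mult.assoc)

lemma in_polys_iff: "F \<in> polys X \<longleftrightarrow> (\<forall>t. Poly_Mapping.lookup F t \<noteq> 0 \<longrightarrow> Poly_Mapping.keys t \<subseteq> X)"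
  by (auto simp: polys_def in_keys_iff)

lemma in_forms_iff:
  "F \<in> forms X m \<longleftrightarrow> (\<forall>t. Poly_Mapping.lookup F t \<noteq> 0 \<longrightarrow> Poly_Mapping.keys t \<subseteq> X \<and> mono_deg t = m)"
  by (auto simp: forms_def in_polys_iff in_keys_iff)

lemma forms_subset_polys: "forms X m \<subseteq> polys X"
  by (auto simp: forms_def)

lemma polys_mono: "Y \<subseteq> X \<Longrightarrow> polys Y \<subseteq> polys X"
  by (auto simp: polys_def)

lemma forms_mono: "Y \<subseteq> X \<Longrightarrow> forms Y m \<subseteq> forms X m"
  using polys_mono by (auto simp: forms_def)

lemma subspace_polys: "cpoly.subspace (polys X)"
  unfolding cpoly.subspace_def
proof (intro conjI ballI allI)
  fix F G assume "F \<in> polys X" "G \<in> polys X"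
  then have "Poly_Mapping.lookup (F + G) t = 0" if "\<not> Poly_Mapping.keys t \<subseteq> X" for t
    using that unfolding in_polys_iff lookup_add by (metis add.right_neutral)
  then show "F + G \<in> polys X" unfolding in_polys_iff by blast
qed (simp_all add: in_polys_iff)

lemma subspace_forms: "cpoly.subspace (forms X m)"
  unfolding cpoly.subspace_def
proof (intro conjI ballI allI)
  fix F G assume "F \<in> forms X m" "G \<in> forms X m"
  then have "Poly_Mapping.lookup (F + G) t = 0" if "\<not> (Poly_Mapping.keys t \<subseteq> X \<and> mono_deg t = m)" for t
    using that unfolding in_forms_iff lookup_add by (metis add.right_neutral)
  then show "F + G \<in> forms X m" unfolding in_forms_iff by blast
qed (simp_all add: in_forms_iff)

lemma monom_poly_in_polys_iff: "monom_poly t \<in> polys X \<longleftrightarrow> Poly_Mapping.keys t \<subseteq> X"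
  by (auto simp: in_polys_iff lookup_single when_def)

lemma monom_poly_in_forms_iff: "monom_poly t \<in> forms X m \<longleftrightarrow> Poly_Mapping.keys t \<subseteq> X \<and> mono_deg t = m"
  by (auto simp: in_forms_iff lookup_single when_def)

lemma one_eq_monom_poly: "(1 :: 'v cpoly) = monom_poly 0"
  by simp

lemma one_in_polys: "1 \<in> polys X"
  unfolding one_eq_monom_poly monom_poly_in_polys_iff by simp

lemma monom_poly_mult: "monom_poly s * monom_poly t = monom_poly (s + t)"
  by (simp add: mult_single)

lemma mult_in_polys:
  assumes "F \<in> polys X" "G \<in> polys X"
  shows "F * G \<in> polys X"
proof (rule clinear_in_subspace[OF clinear_mult_left subspace_polys])
  fix t assume t: "t \<in> Poly_Mapping.keys G"
  show "F * monom_poly t \<in> polys X"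
  proof (rule clinear_in_subspace[OF clinear_mult_right subspace_polys])
    fix s assume "s \<in> Poly_Mapping.keys F"
    then show "monom_poly s * monom_poly t \<in> polys X"
      using assms t unfolding monom_poly_mult monom_poly_in_polys_iff keys_add_nat
      by (auto simp: polys_def)
  qed
qed

lemma mult_in_forms:
  assumes "F \<in> forms X m" "G \<in> forms X n"
  shows "F * G \<in> forms X (m + n)"
proof (rule clinear_in_subspace[OF clinear_mult_left subspace_forms])
  fix t assume t: "t \<in> Poly_Mapping.keys G"
  show "F * monom_poly t \<in> forms X (m + n)"
  proof (rule clinear_in_subspace[OF clinear_mult_right subspace_forms])
    fix s assume "s \<in> Poly_Mapping.keys F"
    then show "monom_poly s * monom_poly t \<in> forms X (m + n)"
      using assms t unfolding monom_poly_mult monom_poly_in_forms_iff keys_add_nat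
      by (auto simp: in_forms_iff in_keys_iff mono_deg_add)
  qed
qed

lemma fin_dim_forms:
  assumes "finite X"
  shows "cpoly.fin_dim (forms X m)"
proof -
  let ?B = "monom_poly ` {t. Poly_Mapping.keys t \<subseteq> X \<and> mono_deg t = m}"
  have "forms X m \<subseteq> cpoly.span ?B"
  proof
    fix F assume F: "F \<in> forms X m"
    show "F \<in> cpoly.span ?B"
    proof (rule clinear_in_subspace[OF clinear_id cpoly.subspace_span])
      fix t assume "t \<in> Poly_Mapping.keys F"
      then have "monom_poly t \<in> ?B" using F by (auto simp: in_forms_iff in_keys_iff)
      then show "monom_poly t \<in> cpoly.span ?B" by (rule cpoly.span_base)
    qed
  qed
  then show ?thesis
    unfolding cpoly.fin_dim_def using finite_imageI[OF finite_monomials[OF assms, of m]] by blast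
qed

lemma fin_dim_subset_forms: "finite X \<Longrightarrow> W \<subseteq> forms X m \<Longrightarrow> cpoly.fin_dim W"
  using cpoly.fin_dim_subset[OF fin_dim_forms] .

subsection \<open>Homogeneous components\<close>

lemma lookup_filter:
  "Poly_Mapping.lookup (\<Sum>t\<in>{t \<in> Poly_Mapping.keys F. P t}. Poly_Mapping.single t (Poly_Mapping.lookup F t)) k =
    (if P k then Poly_Mapping.lookup F k else (0 :: complex))"
proof -
  have "Poly_Mapping.lookup (\<Sum>t\<in>{t \<in> Poly_Mapping.keys F. P t}. Poly_Mapping.single t (Poly_Mapping.lookup F t)) k =
    (\<Sum>t\<in>{t \<in> Poly_Mapping.keys F. P t}. if t = k then Poly_Mapping.lookup F t else 0)"
    by (auto simp: lookup_sum lookup_single when_def intro!: sum.cong)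
  then show ?thesis by (simp add: in_keys_iff)
qed

lemma lookup_form_component:
  "Poly_Mapping.lookup (form_component m F) t = (if mono_deg t = m then Poly_Mapping.lookup F t else 0)"
  unfolding form_component_def by (rule lookup_filter)

lemma form_component_in_forms: "F \<in> polys X \<Longrightarrow> form_component m F \<in> forms X m"
  by (auto simp: in_forms_iff in_polys_iff lookup_form_component split: if_splits)

lemma clinear_form_component: "clinear (form_component m)"
  by (rule clinearI; rule poly_mapping_eqI) (simp_all add: lookup_form_component lookup_add)

lemma form_component_form: "F \<in> forms X n \<Longrightarrow> form_component m F = (if m = n then F else 0)"
  by (rule poly_mapping_eqI) (auto simp: lookup_form_component in_forms_iff)

lemma form_component_zero: "form_component 0 F = Poly_Mapping.single 0 (Poly_Mapping.lookup F 0)"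
  by (rule poly_mapping_eqI) (auto simp: lookup_form_component lookup_single when_def mono_deg_eq_0_iff)

lemma form_component_mult:
  assumes "G \<in> forms X n"
  shows "form_component (n + m) (G * F) = G * form_component m F"
proof (rule clinear_eqI[OF clinear_compose[OF clinear_mult_left clinear_form_component]
      clinear_compose[OF clinear_form_component clinear_mult_left]])
  fix t
  show "form_component (n + m) (G * monom_poly t) = G * form_component m (monom_poly t)"
  proof (rule clinear_eqI[OF clinear_compose[OF clinear_mult_right clinear_form_component] clinear_mult_right])
    fix s assume "s \<in> Poly_Mapping.keys G"
    then have s: "mono_deg s = n" using assms by (simp add: in_forms_iff in_keys_iff)
    have "monom_poly t \<in> forms UNIV (mono_deg t)" "monom_poly (s + t) \<in> forms UNIV (n + mono_deg t)"
      by (simp_all add: monom_poly_in_forms_iff mono_deg_add s)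
    then show "form_component (n + m) (monom_poly s * monom_poly t) = monom_poly s * form_component m (monom_poly t)"
      by (simp add: monom_poly_mult form_component_form)
  qed
qed

subsection \<open>Restriction to a set of variables\<close>

lemma lookup_restrict_vars:
  "Poly_Mapping.lookup (restrict_vars Y F) t = (if Poly_Mapping.keys t \<subseteq> Y then Poly_Mapping.lookup F t else 0)"
  unfolding restrict_vars_def by (rule lookup_filter)

lemma clinear_restrict_vars: "clinear (restrict_vars Y)"
  by (rule clinearI; rule poly_mapping_eqI) (simp_all add: lookup_restrict_vars lookup_add)

lemma restrict_vars_in_polys: "restrict_vars Y F \<in> polys Y"
  by (simp add: in_polys_iff lookup_restrict_vars)

lemma restrict_vars_in_forms: "F \<in> forms X m \<Longrightarrow> restrict_vars Y F \<in> forms Y m"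
  by (auto simp: in_forms_iff lookup_restrict_vars split: if_splits)

lemma restrict_vars_id: "F \<in> polys Y \<Longrightarrow> restrict_vars Y F = F"
  by (rule poly_mapping_eqI) (auto simp: lookup_restrict_vars in_polys_iff)

lemma restrict_vars_monom_poly:
  "restrict_vars Y (monom_poly t) = (if Poly_Mapping.keys t \<subseteq> Y then monom_poly t else 0)"
  by (rule poly_mapping_eqI) (auto simp: lookup_restrict_vars lookup_single when_def)

lemma restrict_vars_one: "restrict_vars Y 1 = 1"
  using restrict_vars_id one_in_polys by blast

lemma restrict_vars_mult: "restrict_vars Y (F * G) = restrict_vars Y F * restrict_vars Y G"
proof (rule clinear_eqI[OF clinear_compose[OF clinear_mult_left clinear_restrict_vars]
      clinear_compose[OF clinear_restrict_vars clinear_mult_left]])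
  fix t
  show "restrict_vars Y (F * monom_poly t) = restrict_vars Y F * restrict_vars Y (monom_poly t)"
    by (rule clinear_eqI[OF clinear_compose[OF clinear_mult_right clinear_restrict_vars]
      clinear_compose[OF clinear_restrict_vars clinear_mult_right]])
      (simp add: monom_poly_mult restrict_vars_monom_poly keys_add_nat)
qed

lemma restrict_vars_form_component: "restrict_vars Y (form_component m F) = form_component m (restrict_vars Y F)"
  by (rule poly_mapping_eqI) (simp add: lookup_restrict_vars lookup_form_component)

lemma restrict_vars_disjoint:
  assumes "F \<in> forms X m" "m \<noteq> 0" "X \<inter> Y = {}"
  shows "restrict_vars Y F = 0"
proof (rule poly_mapping_eqI)
  fix t
  have "Poly_Mapping.lookup F t = 0" if "Poly_Mapping.keys t \<subseteq> Y"
  proof (rule ccontr)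
    assume "Poly_Mapping.lookup F t \<noteq> 0"
    then have "Poly_Mapping.keys t \<subseteq> X" "mono_deg t = m" using assms by (auto simp: in_forms_iff)
    moreover from this have "Poly_Mapping.keys t = {}" using that assms by blast
    ultimately show False using assms(2) by (simp add: mono_deg_def)
  qed
  then show "Poly_Mapping.lookup (restrict_vars Y F) t = Poly_Mapping.lookup 0 t"
    by (simp add: lookup_restrict_vars)
qed

section \<open>Differentiation\<close>

lemma diff_coeff_superset:
  "finite A \<Longrightarrow> Poly_Mapping.keys s \<subseteq> A \<Longrightarrow>
    diff_coeff s t = (\<Prod>v\<in>A. \<Prod>i<Poly_Mapping.lookup s v. Poly_Mapping.lookup t v - i)"
  unfolding diff_coeff_def by (rule prod.mono_neutral_left) (auto simp: in_keys_iff)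

lemma diff_coeff_eq_0_iff: "diff_coeff s t = 0 \<longleftrightarrow> (\<exists>v. Poly_Mapping.lookup t v < Poly_Mapping.lookup s v)"
proof -
  have "(\<exists>i<Poly_Mapping.lookup s v. Poly_Mapping.lookup t v - i = 0) \<longleftrightarrow>
    Poly_Mapping.lookup t v < Poly_Mapping.lookup s v" for v
    by (auto intro: exI[of _ "Poly_Mapping.lookup t v"])
  then have "diff_coeff s t = 0 \<longleftrightarrow>
    (\<exists>v\<in>Poly_Mapping.keys s. Poly_Mapping.lookup t v < Poly_Mapping.lookup s v)"
    unfolding diff_coeff_def by (auto simp: Bex_def)
  then show ?thesis by (auto simp: in_keys_iff)
qed

lemma diff_coeff_add: "diff_coeff (s + s') t = diff_coeff s' t * diff_coeff s (t - s')"
proof -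
  let ?A = "Poly_Mapping.keys s \<union> Poly_Mapping.keys s'"
  let ?p = "\<lambda>n m. \<Prod>i<n. (m :: nat) - i"
  have p_add: "?p (m + n) k = ?p n k * ?p m (k - n)" for m n k
    by (induction m) (simp_all add: algebra_simps)
  have "diff_coeff (s + s') t = (\<Prod>v\<in>?A. ?p (Poly_Mapping.lookup (s + s') v) (Poly_Mapping.lookup t v))"
    by (rule diff_coeff_superset) (simp_all add: keys_add_nat)
  also have "\<dots> = (\<Prod>v\<in>?A. ?p (Poly_Mapping.lookup s' v) (Poly_Mapping.lookup t v)) *
      (\<Prod>v\<in>?A. ?p (Poly_Mapping.lookup s v) (Poly_Mapping.lookup (t - s') v))"
    by (simp only: lookup_add lookup_minus p_add prod.distrib)
  also have "\<dots> = diff_coeff s' t * diff_coeff s (t - s')"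
    using diff_coeff_superset[of ?A s'] diff_coeff_superset[of ?A s] by simp
  finally show ?thesis .
qed

lemma diff_act_superset:
  assumes "finite A" "Poly_Mapping.keys \<Theta> \<subseteq> A" "finite B" "Poly_Mapping.keys F \<subseteq> B"
  shows "diff_act \<Theta> F = (\<Sum>s\<in>A. \<Sum>t\<in>B. Poly_Mapping.single (t - s)
    (Poly_Mapping.lookup \<Theta> s * Poly_Mapping.lookup F t * of_nat (diff_coeff s t)))"
  unfolding diff_act_def
proof (rule sum.mono_neutral_cong_left[OF assms(1,2)])
  fix s
  show "(\<Sum>t\<in>Poly_Mapping.keys F. Poly_Mapping.single (t - s)
      (Poly_Mapping.lookup \<Theta> s * Poly_Mapping.lookup F t * of_nat (diff_coeff s t))) =
    (\<Sum>t\<in>B. Poly_Mapping.single (t - s)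
      (Poly_Mapping.lookup \<Theta> s * Poly_Mapping.lookup F t * of_nat (diff_coeff s t)))"
    by (rule sum.mono_neutral_left[OF assms(3,4)]) (simp add: in_keys_iff)
qed (simp add: in_keys_iff)

lemma clinear_diff_act_left: "clinear (\<lambda>\<Theta>. diff_act \<Theta> F)"
proof (rule clinearI)
  fix x y :: "'a cpoly" and c
  let ?A = "Poly_Mapping.keys x \<union> Poly_Mapping.keys y"
  have "diff_act z F = (\<Sum>s\<in>?A. \<Sum>t\<in>Poly_Mapping.keys F. Poly_Mapping.single (t - s)
    (Poly_Mapping.lookup z s * Poly_Mapping.lookup F t * of_nat (diff_coeff s t)))"
    if "Poly_Mapping.keys z \<subseteq> ?A" for z
    by (rule diff_act_superset) (use that in auto)
  then show "diff_act (x + y) F = diff_act x F + diff_act y F"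
    using keys_add[of x y] by (simp add: lookup_add sum.distrib single_add distrib_right)
  have "diff_act z F = (\<Sum>s\<in>Poly_Mapping.keys x. \<Sum>t\<in>Poly_Mapping.keys F. Poly_Mapping.single (t - s)
    (Poly_Mapping.lookup z s * Poly_Mapping.lookup F t * of_nat (diff_coeff s t)))"
    if "Poly_Mapping.keys z \<subseteq> Poly_Mapping.keys x" for z
    by (rule diff_act_superset) (use that in auto)
  moreover have "Poly_Mapping.keys (cscale c x) \<subseteq> Poly_Mapping.keys x"
    by (auto simp: in_keys_iff)
  ultimately show "diff_act (cscale c x) F = cscale c (diff_act x F)"
    by (simp add: cpoly.scale_sum_right cscale_single mult.assoc)
qed

lemma clinear_diff_act_right: "clinear (\<lambda>F. diff_act \<Theta> F)"
proof (rule clinearI)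
  fix x y :: "'a cpoly" and c
  let ?A = "Poly_Mapping.keys x \<union> Poly_Mapping.keys y"
  have "diff_act \<Theta> z = (\<Sum>s\<in>Poly_Mapping.keys \<Theta>. \<Sum>t\<in>?A. Poly_Mapping.single (t - s)
    (Poly_Mapping.lookup \<Theta> s * Poly_Mapping.lookup z t * of_nat (diff_coeff s t)))"
    if "Poly_Mapping.keys z \<subseteq> ?A" for z
    by (rule diff_act_superset) (use that in auto)
  then show "diff_act \<Theta> (x + y) = diff_act \<Theta> x + diff_act \<Theta> y"
    using keys_add[of x y] by (simp add: lookup_add sum.distrib single_add distrib_right distrib_left)
  have "diff_act \<Theta> z = (\<Sum>s\<in>Poly_Mapping.keys \<Theta>. \<Sum>t\<in>Poly_Mapping.keys x. Poly_Mapping.single (t - s)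
    (Poly_Mapping.lookup \<Theta> s * Poly_Mapping.lookup z t * of_nat (diff_coeff s t)))"
    if "Poly_Mapping.keys z \<subseteq> Poly_Mapping.keys x" for z
    by (rule diff_act_superset) (use that in auto)
  moreover have "Poly_Mapping.keys (cscale c x) \<subseteq> Poly_Mapping.keys x"
    by (auto simp: in_keys_iff)
  ultimately show "diff_act \<Theta> (cscale c x) = cscale c (diff_act \<Theta> x)"
    by (simp add: cpoly.scale_sum_right cscale_single mult.assoc mult.left_commute)
qed

lemma diff_act_monom_poly:
  "diff_act (monom_poly s) (monom_poly t) = cscale (of_nat (diff_coeff s t)) (monom_poly (t - s))"
  by (simp add: diff_act_def cscale_single)

lemma diff_act_mult: "diff_act (\<Theta> * \<Psi>) F = diff_act \<Theta> (diff_act \<Psi> F)"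
proof (rule clinear_eqI[OF clinear_diff_act_right clinear_compose[OF clinear_diff_act_right clinear_diff_act_right]])
  fix t
  show "diff_act (\<Theta> * \<Psi>) (monom_poly t) = diff_act \<Theta> (diff_act \<Psi> (monom_poly t))"
  proof (rule clinear_eqI[OF clinear_compose[OF clinear_mult_left clinear_diff_act_left]
        clinear_compose[OF clinear_diff_act_left clinear_diff_act_right]])
    fix s'
    show "diff_act (\<Theta> * monom_poly s') (monom_poly t) = diff_act \<Theta> (diff_act (monom_poly s') (monom_poly t))"
    proof (rule clinear_eqI[OF clinear_compose[OF clinear_mult_right clinear_diff_act_left] clinear_diff_act_left])
      fix s
      have "t - (s + s') = t - s' - s" by (simp add: diff_diff_add add.commute)
      then show "diff_act (monom_poly s * monom_poly s') (monom_poly t) =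
          diff_act (monom_poly s) (diff_act (monom_poly s') (monom_poly t))"
        by (simp add: monom_poly_mult diff_act_monom_poly cpoly_pair.linear_scale[OF clinear_diff_act_right]
          diff_coeff_add)
    qed
  qed
qed

lemma diff_act_in_forms:
  assumes "\<Theta> \<in> forms X m" "F \<in> forms X d"
  shows "diff_act \<Theta> F \<in> forms X (d - m)"
proof (rule clinear_in_subspace[OF clinear_diff_act_left subspace_forms])
  fix s assume s: "s \<in> Poly_Mapping.keys \<Theta>"
  show "diff_act (monom_poly s) F \<in> forms X (d - m)"
  proof (rule clinear_in_subspace[OF clinear_diff_act_right subspace_forms])
    fix t assume t: "t \<in> Poly_Mapping.keys F"
    show "diff_act (monom_poly s) (monom_poly t) \<in> forms X (d - m)"
    proof (cases "diff_coeff s t = 0")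
      case True
      then show ?thesis using cpoly.subspace_0[OF subspace_forms] by (simp add: diff_act_monom_poly)
    next
      case False
      then have le: "Poly_Mapping.lookup s v \<le> Poly_Mapping.lookup t v" for v
        using diff_coeff_eq_0_iff[of s t] not_less by blast
      then have "t = s + (t - s)" by (intro poly_mapping_eqI) (simp add: lookup_add lookup_minus)
      then have "Poly_Mapping.keys t = Poly_Mapping.keys s \<union> Poly_Mapping.keys (t - s)"
        "mono_deg t = mono_deg s + mono_deg (t - s)"
        by (metis keys_add_nat, metis mono_deg_add)
      moreover have "mono_deg s = m" "mono_deg t = d" "Poly_Mapping.keys t \<subseteq> X"
        using assms s t by (auto simp: in_forms_iff in_keys_iff)
      ultimately have "monom_poly (t - s) \<in> forms X (d - m)" by (simp add: monom_poly_in_forms_iff)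
      then show ?thesis unfolding diff_act_monom_poly by (rule cpoly.subspace_scale[OF subspace_forms])
    qed
  qed
qed

lemma diff_act_restrict_vars:
  assumes "F \<in> polys X"
  shows "diff_act (restrict_vars X \<Theta>) F = diff_act \<Theta> F"
proof (rule clinear_eqI[OF clinear_compose[OF clinear_restrict_vars clinear_diff_act_left] clinear_diff_act_left])
  fix s
  show "diff_act (restrict_vars X (monom_poly s)) F = diff_act (monom_poly s) F"
  proof (rule clinear_eqI[OF clinear_diff_act_right clinear_diff_act_right])
    fix t assume "t \<in> Poly_Mapping.keys F"
    then have t: "Poly_Mapping.keys t \<subseteq> X" using assms by (simp add: in_polys_iff in_keys_iff)
    show "diff_act (restrict_vars X (monom_poly s)) (monom_poly t) = diff_act (monom_poly s) (monom_poly t)"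
    proof (cases "Poly_Mapping.keys s \<subseteq> X")
      case False
      then obtain v where "v \<in> Poly_Mapping.keys s" "v \<notin> Poly_Mapping.keys t" using t by blast
      then have "Poly_Mapping.lookup t v < Poly_Mapping.lookup s v" by (simp add: in_keys_iff)
      then have "diff_coeff s t = 0" using diff_coeff_eq_0_iff by blast
      then show ?thesis
        using False by (simp add: restrict_vars_monom_poly diff_act_monom_poly
          cpoly_pair.linear_0[OF clinear_diff_act_left])
    qed (simp add: restrict_vars_monom_poly)
  qed
qed

text \<open>Between operators and forms of the same degree, differentiation is a perfect pairing: up to
  nonzero factors, the monomials are dual to each other.\<close>

lemma diff_act_monom_poly_form:
  assumes "F \<in> forms X (mono_deg s)"
  shows "diff_act (monom_poly s) F = Poly_Mapping.single 0 (Poly_Mapping.lookup F s * of_nat (diff_coeff s s))"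
proof -
  have "diff_coeff s t = 0" if "t \<in> Poly_Mapping.keys F" "t \<noteq> s" for t
  proof (rule ccontr)
    assume "diff_coeff s t \<noteq> 0"
    then have "Poly_Mapping.lookup s v \<le> Poly_Mapping.lookup t v" for v
      using diff_coeff_eq_0_iff[of s t] not_less by blast
    then have eq: "t = s + (t - s)" by (intro poly_mapping_eqI) (simp add: lookup_add lookup_minus)
    then have "mono_deg t = mono_deg s + mono_deg (t - s)" by (metis mono_deg_add)
    moreover have "mono_deg t = mono_deg s" using assms that(1) by (simp add: in_forms_iff in_keys_iff)
    ultimately have "t - s = 0" by (simp add: mono_deg_eq_0_iff)
    then show False using eq that(2) by simp
  qed
  note zero = this
  have "diff_act (monom_poly s) F = (\<Sum>t\<in>Poly_Mapping.keys F.
      Poly_Mapping.single (t - s) (Poly_Mapping.lookup F t * of_nat (diff_coeff s t)))"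
    by (simp add: diff_act_def)
  also have "\<dots> = (\<Sum>t\<in>Poly_Mapping.keys F.
      if t = s then Poly_Mapping.single 0 (Poly_Mapping.lookup F s * of_nat (diff_coeff s s)) else 0)"
    by (rule sum.cong) (use zero in auto)
  also have "\<dots> = Poly_Mapping.single 0 (Poly_Mapping.lookup F s * of_nat (diff_coeff s s))"
    by (simp add: in_keys_iff)
  finally show ?thesis .
qed

lemma diff_coeff_self_nonzero: "diff_coeff s s \<noteq> 0"
  by (simp add: diff_coeff_eq_0_iff)

section \<open>Ideals of the polynomial ring\<close>

lemma uminus_eq_cscale: "- F = cscale (- 1) F"
  by (rule poly_mapping_eqI) simp

lemma cring_poly_ring: "cring (poly_ring X)"
proof (rule cringI)
  show "abelian_group (poly_ring X)"
  proof (rule abelian_groupI)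
    fix F assume "F \<in> carrier (poly_ring X)"
    then show "\<exists>G\<in>carrier (poly_ring X). G \<oplus>\<^bsub>poly_ring X\<^esub> F = \<zero>\<^bsub>poly_ring X\<^esub>"
      using cpoly.subspace_neg[OF subspace_polys] by (intro bexI[of _ "- F"]) (auto simp: poly_ring_def)
  qed (auto simp: poly_ring_def cpoly.subspace_add[OF subspace_polys] cpoly.subspace_0[OF subspace_polys]
      algebra_simps)
  show "Group.comm_monoid (poly_ring X)"
    by (rule comm_monoidI) (auto simp: poly_ring_def mult_in_polys one_in_polys algebra_simps)
qed (auto simp: poly_ring_def distrib_right)

lemma ideal_poly_ring_iff:
  "ideal Z (poly_ring X) \<longleftrightarrow> Z \<subseteq> polys X \<and> 0 \<in> Z \<and> (\<forall>F\<in>Z. \<forall>G\<in>Z. F + G \<in> Z) \<and>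
    (\<forall>F\<in>Z. \<forall>G\<in>polys X. G * F \<in> Z)"
proof
  assume "ideal Z (poly_ring X)"
  then interpret ideal Z "poly_ring X" .
  show "Z \<subseteq> polys X \<and> 0 \<in> Z \<and> (\<forall>F\<in>Z. \<forall>G\<in>Z. F + G \<in> Z) \<and> (\<forall>F\<in>Z. \<forall>G\<in>polys X. G * F \<in> Z)"
    using a_subset I_l_closed additive_subgroup.zero_closed[OF is_additive_subgroup]
      additive_subgroup.a_closed[OF is_additive_subgroup] by (simp add: poly_ring_def)
next
  assume Z: "Z \<subseteq> polys X \<and> 0 \<in> Z \<and> (\<forall>F\<in>Z. \<forall>G\<in>Z. F + G \<in> Z) \<and> (\<forall>F\<in>Z. \<forall>G\<in>polys X. G * F \<in> Z)"
  interpret R: cring "poly_ring X" by (rule cring_poly_ring)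
  show "ideal Z (poly_ring X)"
  proof (rule idealI)
    show "ring (poly_ring X)" by (rule R.ring_axioms)
    show "subgroup Z (add_monoid (poly_ring X))"
    proof (rule R.add.subgroupI)
      show "Z \<noteq> {}" using Z by blast
      show "\<ominus>\<^bsub>poly_ring X\<^esub> F \<in> Z" if F: "F \<in> Z" for F
      proof -
        have FX: "F \<in> carrier (poly_ring X)" using F Z by (auto simp: poly_ring_def)
        have "cscale (- 1) 1 \<in> polys X" by (rule cpoly.subspace_scale[OF subspace_polys one_in_polys])
        then have "cscale (- 1) 1 * F \<in> Z" using Z F by blast
        then have mem: "- F \<in> Z" unfolding uminus_eq_cscale[of F] cscale_mult_left[symmetric] by simp
        then have "- F \<in> carrier (poly_ring X)" using Z by (auto simp: poly_ring_def)
        then have "\<ominus>\<^bsub>poly_ring X\<^esub> F = - F"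
          using R.minus_equality[OF _ FX] by (simp add: poly_ring_def)
        then show ?thesis using mem by simp
      qed
    qed (use Z in \<open>auto simp: poly_ring_def\<close>)
  qed (use Z in \<open>auto simp: poly_ring_def mult.commute\<close>)
qed

lemma primeideal_poly_ring_iff:
  "primeideal P (poly_ring X) \<longleftrightarrow> ideal P (poly_ring X) \<and> 1 \<notin> P \<and>
    (\<forall>F\<in>polys X. \<forall>G\<in>polys X. F * G \<in> P \<longrightarrow> F \<in> P \<or> G \<in> P)"
proof
  assume "primeideal P (poly_ring X)"
  then interpret primeideal P "poly_ring X" .
  have "1 \<notin> P" using one_imp_carrier I_notcarr by (auto simp: poly_ring_def)
  then show "ideal P (poly_ring X) \<and> 1 \<notin> P \<and> (\<forall>F\<in>polys X. \<forall>G\<in>polys X. F * G \<in> P \<longrightarrow> F \<in> P \<or> G \<in> P)"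
    using is_ideal I_prime by (simp add: poly_ring_def)
next
  assume P: "ideal P (poly_ring X) \<and> 1 \<notin> P \<and> (\<forall>F\<in>polys X. \<forall>G\<in>polys X. F * G \<in> P \<longrightarrow> F \<in> P \<or> G \<in> P)"
  then show "primeideal P (poly_ring X)"
    using one_in_polys[of X] by (intro primeidealI cring_poly_ring) (auto simp: poly_ring_def)
qed

lemma ideal_subset_polys: "ideal Z (poly_ring X) \<Longrightarrow> Z \<subseteq> polys X"
  by (simp add: ideal_poly_ring_iff)

lemma ideal_mult: "ideal Z (poly_ring X) \<Longrightarrow> F \<in> Z \<Longrightarrow> G \<in> polys X \<Longrightarrow> G * F \<in> Z"
  by (simp add: ideal_poly_ring_iff)

lemma subspace_ideal: "ideal Z (poly_ring X) \<Longrightarrow> cpoly.subspace Z"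
proof -
  assume Z: "ideal Z (poly_ring X)"
  have "Poly_Mapping.single 0 c \<in> polys X" for c
    by (auto simp: in_polys_iff lookup_single when_def)
  then have "cscale c F \<in> Z" if "F \<in> Z" for c F
    using ideal_mult[OF Z that] by (simp add: cscale_def)
  then show ?thesis using Z by (simp add: cpoly.subspace_def ideal_poly_ring_iff)
qed

lemma homogeneousD: "homogeneous Z \<Longrightarrow> F \<in> Z \<Longrightarrow> form_component m F \<in> Z"
  by (simp add: homogeneous_def)

lemma closed_subscheme_ideal: "closed_subscheme X Z \<Longrightarrow> ideal Z (poly_ring X)"
  by (simp add: closed_subscheme_def)

lemma closed_subscheme_saturated:
  "closed_subscheme X Z \<Longrightarrow> F \<in> polys X \<Longrightarrow> (\<And>G. G \<in> forms X N \<Longrightarrow> G * F \<in> Z) \<Longrightarrow> F \<in> Z"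
  unfolding closed_subscheme_def by blast

section \<open>The Hilbert function is bounded by the degree\<close>

text \<open>There is a form \<open>f\<close> of arbitrarily large degree that is a nonzerodivisor modulo \<open>Z\<close> as far as
  the given finite-dimensional space \<open>V\<close> is concerned. Let \<open>f\<close> have maximal rank modulo \<open>Z\<close> on \<open>V\<close>
  among all forms of degree at least \<open>n\<close>, and suppose that \<open>f\<close> is not injective. By induction on the
  dimension of \<open>V\<close> modulo \<open>Z\<close>, some \<open>f'\<close> is injective on \<open>f V\<close>, and maximality forces \<open>f\<close>, \<open>f'\<close> and \<open>f' f\<close> to have the
  same kernel. If \<open>u\<close> is in this kernel and \<open>h\<close> has the degree of \<open>f\<close>, then \<open>h u = f w\<close> for some \<open>w\<close>
  in \<open>V\<close> by \<open>max_rank_kernel\<close>, and \<open>f' f w = h f' u = 0\<close> gives \<open>f w = 0\<close>. So all such \<open>h\<close>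
  annihilate \<open>u\<close> modulo \<open>Z\<close>, and saturation yields \<open>u \<in> Z\<close>.\<close>

lemma ex_nonzerodivisor_on:
  assumes Z: "closed_subscheme X Z" and X: "finite X"
    and q: "clinear q" "\<And>x. q x = 0 \<longleftrightarrow> x \<in> Z"
  shows "cpoly.subspace V \<Longrightarrow> V \<subseteq> forms X b \<Longrightarrow>
    \<exists>N\<ge>n. \<exists>f\<in>forms X N. \<forall>u\<in>V. f * u \<in> Z \<longrightarrow> u \<in> Z"
proof (induction "cpoly.dim (q ` V)" arbitrary: V b rule: less_induct)
  case (less V b)
  note V = less.prems
  have Zi: "ideal Z (poly_ring X)" using closed_subscheme_ideal[OF Z] .
  have Zsub: "cpoly.subspace Z" using subspace_ideal[OF Zi] .
  have Zm: "g * x \<in> Z" if "x \<in> Z" "g \<in> forms X m" for g x m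
    using ideal_mult[OF Zi that(1)] that(2) forms_subset_polys by blast
  have finV: "cpoly.fin_dim V" using fin_dim_subset_forms[OF X V(2)] .
  define K where "K f = {u \<in> V. f * u \<in> Z}" for f
  have lin: "clinear (\<lambda>u. q (f * u))" for f by (rule clinear_compose[OF clinear_mult_left q(1)])
  have rank: "cpoly.dim V = cpoly.dim (K f) + cpoly.dim ((\<lambda>u. q (f * u)) ` V)" for f
    using cpoly_pair.dim_kernel_plus_image[OF lin V(1) finV, of f] by (simp add: q(2) K_def)
  have subK: "cpoly.subspace (K f)" for f
  proof -
    have "K f = V \<inter> {u. q (f * u) = 0}" by (auto simp: K_def q(2))
    then show ?thesis
      using cpoly.subspace_inter[OF V(1) cpoly_pair.linear_subspace_kernel[OF lin]] by simp
  qed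
  have finK: "cpoly.fin_dim (K f)" for f
    using cpoly.fin_dim_subset[OF finV, of "K f"] by (auto simp: K_def)
  (* A form of maximal rank is one with a kernel of least dimension. *)
  define P where "P x \<longleftrightarrow> n \<le> fst x \<and> snd x \<in> forms X (fst x)" for x :: "nat \<times> 'a cpoly"
  have "P (n, 0)" using cpoly.subspace_0[OF subspace_forms] by (simp add: P_def)
  then obtain x where x: "P x" "\<And>y. P y \<Longrightarrow> cpoly.dim (K (snd x)) \<le> cpoly.dim (K (snd y))"
    using ex_has_least_nat[of P "(n, 0)" "\<lambda>x. cpoly.dim (K (snd x))"] by blast
  obtain N f where Nf: "x = (N, f)" by force
  have N: "N \<ge> n" "f \<in> forms X N" using x(1) Nf by (simp_all add: P_def)
  have min: "cpoly.dim (K f) \<le> cpoly.dim (K g)" if "m \<ge> n" "g \<in> forms X m" for m g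
    using x(2)[of "(m, g)"] that Nf by (simp add: P_def)
  show ?case
  proof (cases "\<forall>u\<in>V. f * u \<in> Z \<longrightarrow> u \<in> Z")
    case True
    then show ?thesis using N by blast
  next
    case False
    then obtain u where u: "u \<in> V" "f * u \<in> Z" "u \<notin> Z" by blast
    define V' where "V' = (\<lambda>u. f * u) ` V"
    have V': "cpoly.subspace V'" "V' \<subseteq> forms X (N + b)"
      unfolding V'_def using cpoly_pair.linear_subspace_image[OF clinear_mult_left V(1)]
        mult_in_forms[OF N(2)] V(2) by blast+
    have "cpoly.dim (q ` V') < cpoly.dim (q ` V)"
    proof (rule ccontr)
      assume "\<not> ?thesis"
      then have le: "cpoly.dim (q ` V) \<le> cpoly.dim ((\<lambda>u. q (f * u)) ` V)"
        by (simp add: V'_def image_image)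
      have "cpoly.dim (K f) \<le> cpoly.dim (K 1)"
        using le rank[of f] rank[of 1, unfolded mult_1] by linarith
      moreover have "K 1 \<subseteq> K f" using Zm N(2) by (auto simp: K_def)
      ultimately have "K 1 = K f" using cpoly.subspace_eq_if_dim_le[OF subK _ finK] by blast
      then show False using u by (auto simp: K_def)
    qed
    then obtain N' f' where f': "N' \<ge> n" "f' \<in> forms X N'" "\<And>v. v \<in> V' \<Longrightarrow> f' * v \<in> Z \<Longrightarrow> v \<in> Z"
      using less.hyps[OF _ V'] by blast
    have inj: "f * w \<in> Z" if "w \<in> V" "f' * (f * w) \<in> Z" for w
      using f'(3)[of "f * w"] that by (simp add: V'_def)
    have "K f' \<subseteq> K f"
    proof
      fix w assume "w \<in> K f'"
      then have w: "w \<in> V" "f' * w \<in> Z" by (simp_all add: K_def)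
      have "f' * (f * w) = f * (f' * w)" by (simp add: mult.left_commute)
      then have "f' * (f * w) \<in> Z" by (rule ssubst) (rule Zm[OF w(2) N(2)])
      then show "w \<in> K f" using inj w(1) by (simp add: K_def)
    qed
    then have K_eq: "K f' = K f"
      using cpoly.subspace_eq_if_dim_le[OF subK _ finK] min[OF f'(1,2)] by blast
    have "h * u \<in> Z" if h: "h \<in> forms X N" for h
    proof -
      have "cpoly.dim ((\<lambda>x. q (f * x) + cscale \<epsilon> (q (h * x))) ` V) \<le> cpoly.dim ((\<lambda>x. q (f * x)) ` V)" for \<epsilon>
      proof -
        have "q (f * x) + cscale \<epsilon> (q (h * x)) = q ((f + cscale \<epsilon> h) * x)" for x
          by (simp add: distrib_right cpoly_pair.linear_add[OF q(1)] cpoly_pair.linear_scale[OF q(1)]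
            cscale_mult_left[symmetric])
        moreover have "f + cscale \<epsilon> h \<in> forms X N"
          by (intro cpoly.subspace_add[OF subspace_forms] cpoly.subspace_scale[OF subspace_forms] N h)
        ultimately show ?thesis
          using min[OF N(1), of "f + cscale \<epsilon> h"] rank[of f] rank[of "f + cscale \<epsilon> h"] by simp
      qed
      moreover have "q (f * u) = 0" using u(2) q(2) by simp
      ultimately have "q (h * u) \<in> (\<lambda>x. q (f * x)) ` V"
        using max_rank_kernel[OF lin lin V(1) finV _ u(1)] by blast
      then obtain w where w: "w \<in> V" "q (h * u) = q (f * w)" by blast
      then have "q (h * u - f * w) = 0" by (simp add: cpoly_pair.linear_diff[OF q(1)])
      then have diff: "h * u - f * w \<in> Z" using q(2) by simp
      have "f' * u \<in> Z" using K_eq u by (auto simp: K_def)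
      then have "h * (f' * u) \<in> Z" using Zm h by blast
      moreover have "f' * (h * u - f * w) \<in> Z" using Zm[OF diff f'(2)] .
      ultimately have "h * (f' * u) - f' * (h * u - f * w) \<in> Z"
        using cpoly.subspace_diff[OF Zsub] by blast
      also have "h * (f' * u) - f' * (h * u - f * w) = f' * (f * w)"
        by (simp add: algebra_simps)
      finally have "f * w \<in> Z" using inj[OF w(1)] by blast
      then have "(h * u - f * w) + f * w \<in> Z" using diff cpoly.subspace_add[OF Zsub] by blast
      then show ?thesis by simp
    qed
    then have "u \<in> Z"
      using closed_subscheme_saturated[OF Z] u(1) V(2) forms_subset_polys by blast
    then show ?thesis using u(3) by blast
  qed
qed

lemma hilbert_function_le_degree:
  assumes Z: "closed_subscheme X Z" and X: "finite X" and r: "has_degree X Z r"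
  shows "hilbert_function X Z a \<le> r"
proof -
  obtain n where n: "\<And>m. m \<ge> n \<Longrightarrow> hilbert_function X Z m = r"
    using r unfolding has_degree_def eventually_sequentially by blast
  have Zi: "ideal Z (poly_ring X)" using closed_subscheme_ideal[OF Z] .
  obtain q where q: "clinear q" "\<And>x. q x = 0 \<longleftrightarrow> x \<in> Z"
    using subspace_is_kernel[OF subspace_ideal[OF Zi]] by blast
  obtain N f where f: "N \<ge> n" "f \<in> forms X N" "\<And>u. u \<in> forms X a \<Longrightarrow> f * u \<in> Z \<Longrightarrow> u \<in> Z"
    using ex_nonzerodivisor_on[OF Z X q subspace_forms order_refl] by blast
  have hf: "hilbert_function X Z m = cpoly.dim (q ` forms X m)" for m
  proof -
    have "{x \<in> forms X m. q x = 0} = Z \<inter> forms X m" using q(2) by blast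
    then show ?thesis
      using cpoly_pair.dim_kernel_plus_image[OF q(1) subspace_forms fin_dim_forms[OF X], of m]
      unfolding hilbert_function_def by simp
  qed
  have lin: "clinear (\<lambda>u. q (f * u))" by (rule clinear_compose[OF clinear_mult_left q(1)])
  have "{u \<in> forms X a. q (f * u) = 0} = Z \<inter> forms X a"
    using q(2) f(2,3) ideal_mult[OF Zi] forms_subset_polys by blast
  then have "hilbert_function X Z a = cpoly.dim ((\<lambda>u. q (f * u)) ` forms X a)"
    using cpoly_pair.dim_kernel_plus_image[OF lin subspace_forms fin_dim_forms[OF X], of a]
    unfolding hilbert_function_def by simp
  also have "\<dots> \<le> cpoly.dim (q ` forms X (N + a))"
  proof (rule cpoly.dim_mono_fin_dim)
    show "(\<lambda>u. q (f * u)) ` forms X a \<subseteq> q ` forms X (N + a)" using mult_in_forms[OF f(2)] by blast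
    show "cpoly.fin_dim (q ` forms X (N + a))"
      by (rule cpoly_pair.fin_dim_image[OF q(1) fin_dim_forms[OF X]])
  qed
  also have "\<dots> = r" using n[of "N + a"] f(1) hf by simp
  finally show ?thesis .
qed

section \<open>Spaces of derivatives\<close>

lemma derivs_eq_image:
  assumes "F \<in> polys X"
  shows "derivs d F a = (\<lambda>\<Theta>. diff_act \<Theta> F) ` forms X (d - a)"
proof
  let ?I = "(\<lambda>\<Theta>. diff_act \<Theta> F) ` forms X (d - a)"
  have sub: "cpoly.subspace ?I"
    by (rule cpoly_pair.linear_subspace_image[OF clinear_diff_act_left subspace_forms])
  show "derivs d F a \<subseteq> ?I"
    unfolding derivs_def
  proof (rule cpoly.span_minimal[OF _ sub], clarify)
    fix s :: "'a \<Rightarrow>\<^sub>0 nat" assume s: "mono_deg s = d - a"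
    have "monom_poly s \<in> forms UNIV (d - a)" using s by (simp add: monom_poly_in_forms_iff)
    then have "restrict_vars X (monom_poly s) \<in> forms X (d - a)" by (rule restrict_vars_in_forms)
    then show "diff_act (monom_poly s) F \<in> ?I"
      unfolding diff_act_restrict_vars[OF assms, symmetric, of "monom_poly s"] by blast
  qed
  show "?I \<subseteq> derivs d F a"
  proof clarify
    fix \<Theta> assume \<Theta>: "\<Theta> \<in> forms X (d - a)"
    show "diff_act \<Theta> F \<in> derivs d F a"
      unfolding derivs_def
    proof (rule clinear_in_subspace[OF clinear_diff_act_left cpoly.subspace_span])
      fix s assume "s \<in> Poly_Mapping.keys \<Theta>"
      then have "mono_deg s = d - a" using \<Theta> by (simp add: in_forms_iff in_keys_iff)
      then show "diff_act (monom_poly s) F \<in> cpoly.span {diff_act (monom_poly s) F |s. mono_deg s = d - a}"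
        by (intro cpoly.span_base) blast
    qed
  qed
qed

lemma subspace_derivs: "cpoly.subspace (derivs d F a)"
  unfolding derivs_def by (rule cpoly.subspace_span)

lemma derivs_subset_forms: "F \<in> forms X d \<Longrightarrow> a \<le> d \<Longrightarrow> derivs d F a \<subseteq> forms X a"
proof
  fix G assume F: "F \<in> forms X d" and a: "a \<le> d" and G: "G \<in> derivs d F a"
  then have "F \<in> polys X" using forms_subset_polys by blast
  then obtain \<Theta> where \<Theta>: "\<Theta> \<in> forms X (d - a)" "G = diff_act \<Theta> F"
    using G derivs_eq_image[of F X d a] by auto
  then show "G \<in> forms X a" using diff_act_in_forms[OF \<Theta>(1) F] a by simp
qed

lemma dim_derivs_plus_dim_apolar:
  assumes "F \<in> polys X" "finite X"
  shows "cpoly.dim (forms X (d - a)) =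
    cpoly.dim (apolar_ideal X F \<inter> forms X (d - a)) + cpoly.dim (derivs d F a)"
proof -
  have "{\<Theta> \<in> forms X (d - a). diff_act \<Theta> F = 0} = apolar_ideal X F \<inter> forms X (d - a)"
    using forms_subset_polys by (auto simp: apolar_ideal_def)
  then show ?thesis
    using cpoly_pair.dim_kernel_plus_image[OF clinear_diff_act_left[of F] subspace_forms
        fin_dim_forms[OF assms(2)], of "d - a"] derivs_eq_image[OF assms(1), of d a] by simp
qed

lemma dim_derivs_le_hilbert_function:
  assumes "F \<in> polys X" "finite X" "Z \<subseteq> apolar_ideal X F"
  shows "cpoly.dim (derivs d F a) \<le> hilbert_function X Z (d - a)"
proof -
  have "cpoly.dim (Z \<inter> forms X (d - a)) \<le> cpoly.dim (apolar_ideal X F \<inter> forms X (d - a))"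
    using assms(3) by (intro cpoly.dim_mono_fin_dim fin_dim_subset_forms[OF assms(2)]) auto
  then show ?thesis
    using dim_derivs_plus_dim_apolar[OF assms(1,2), of d a] unfolding hilbert_function_def by linarith
qed

text \<open>The catalecticant map \<open>\<Theta> \<mapsto> \<Theta> F\<close> in degree \<open>d - a\<close> is the transpose of the one in degree \<open>a\<close>, so both
  have the same rank. The proof dualizes a basis of one image by means of the differentiation pairing.\<close>

lemma dim_derivs_symmetric_le:
  assumes F: "F \<in> forms X d" and X: "finite X" and a: "a \<le> d"
  shows "cpoly.dim (derivs d F a) \<le> cpoly.dim (derivs d F (d - a))"
proof -
  have FX: "F \<in> polys X" using F forms_subset_polys by blast
  have sub: "derivs d F a \<subseteq> forms X a" using derivs_subset_forms[OF F a] .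
  obtain E where E: "finite E" "cpoly.independent E" "cpoly.span E = derivs d F a"
      "card E = cpoly.dim (derivs d F a)"
    by (rule cpoly.fin_dim_basis[OF subspace_derivs fin_dim_subset_forms[OF X sub]]) (rule that)
  have E_sub: "E \<subseteq> derivs d F a" using cpoly.span_superset[of E] E(3) by simp
  then have "\<forall>e\<in>E. \<exists>\<Psi>\<in>forms X (d - a). e = diff_act \<Psi> F"
    unfolding derivs_eq_image[OF FX] by fastforce
  then obtain \<psi> where \<psi>: "\<And>e. e \<in> E \<Longrightarrow> \<psi> e \<in> forms X (d - a)" "\<And>e. e \<in> E \<Longrightarrow> e = diff_act (\<psi> e) F"
    by metis
  define B where "B = cpoly.extend_basis E"
  have B: "E \<subseteq> B" "cpoly.independent B" "cpoly.span B = UNIV"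
    unfolding B_def using cpoly.extend_basis_superset[OF E(2)] cpoly.independent_extend_basis[OF E(2)]
      cpoly.span_extend_basis[OF E(2)] by simp_all
  define f where "f e x = cpoly.representation B x e" for e x
  have f_basis: "f e e' = (if e = e' then 1 else 0)" if "e' \<in> E" for e e'
    unfolding f_def using cpoly.representation_basis[OF B(2)] that B(1) by auto
  define M where "M = {t. Poly_Mapping.keys t \<subseteq> X \<and> mono_deg t = a}"
  have finM: "finite M" unfolding M_def by (rule finite_monomials[OF X])
  have f_expand: "f e w = (\<Sum>t\<in>M. Poly_Mapping.lookup w t * f e (monom_poly t))" if w: "w \<in> forms X a" for e w
  proof -
    have "f e w = f e (\<Sum>t\<in>Poly_Mapping.keys w. cscale (Poly_Mapping.lookup w t) (monom_poly t))"
      using monomial_expansion[of w] by simp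
    also have "\<dots> = (\<Sum>t\<in>Poly_Mapping.keys w. Poly_Mapping.lookup w t * f e (monom_poly t))"
      unfolding f_def by (simp add: cpoly.representation_sum[OF B(2)] cpoly.representation_scale[OF B(2)] B(3))
    also have "\<dots> = (\<Sum>t\<in>M. Poly_Mapping.lookup w t * f e (monom_poly t))"
      by (rule sum.mono_neutral_left[OF finM])
        (use w in \<open>auto simp: M_def in_forms_iff in_keys_iff\<close>)
    finally show ?thesis .
  qed
  define \<theta> where "\<theta> e = (\<Sum>t\<in>M. cscale (f e (monom_poly t) / of_nat (diff_coeff t t)) (monom_poly t))" for e
  have \<theta>_form: "\<theta> e \<in> forms X a" for e
    unfolding \<theta>_def
    by (intro cpoly.subspace_sum[OF subspace_forms] cpoly.subspace_scale[OF subspace_forms])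
      (simp add: M_def monom_poly_in_forms_iff)
  have \<theta>_dual: "diff_act (\<theta> e) w = Poly_Mapping.single 0 (f e w)" if w: "w \<in> forms X a" for e w
  proof -
    have "diff_act (\<theta> e) w =
      (\<Sum>t\<in>M. cscale (f e (monom_poly t) / of_nat (diff_coeff t t)) (diff_act (monom_poly t) w))"
      unfolding \<theta>_def
      by (simp add: cpoly_pair.linear_sum[OF clinear_diff_act_left] cpoly_pair.linear_scale[OF clinear_diff_act_left])
    also have "\<dots> = (\<Sum>t\<in>M. Poly_Mapping.single 0 (Poly_Mapping.lookup w t * f e (monom_poly t)))"
    proof (rule sum.cong[OF refl])
      fix t assume "t \<in> M"
      then have "w \<in> forms X (mono_deg t)" using w by (simp add: M_def)
      from diff_act_monom_poly_form[OF this]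
      show "cscale (f e (monom_poly t) / of_nat (diff_coeff t t)) (diff_act (monom_poly t) w) =
          Poly_Mapping.single 0 (Poly_Mapping.lookup w t * f e (monom_poly t))"
        using diff_coeff_self_nonzero[of t] by (simp add: cscale_single mult.commute)
    qed
    also have "\<dots> = Poly_Mapping.single 0 (f e w)"
      unfolding f_expand[OF w] by (rule poly_mapping_eqI) (simp add: lookup_sum lookup_single when_def)
    finally show ?thesis .
  qed
  define p where "p e = diff_act (\<theta> e) F" for e
  have p_mem: "p ` E \<subseteq> derivs d F (d - a)"
    unfolding derivs_eq_image[OF FX] p_def using \<theta>_form a by auto
  have "inj_on p E \<and> cpoly.independent (p ` E)"
  proof (rule cpoly.independent_familyI[OF E(1)])
    fix c e' assume zero: "(\<Sum>e\<in>E. cscale (c e) (p e)) = 0" and e': "e' \<in> E"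
    have e'_form: "e' \<in> forms X a" using e' E_sub sub by blast
    have swap: "diff_act (\<psi> e') (p e) = diff_act (\<theta> e) e'" for e
    proof -
      have "diff_act (\<psi> e') (p e) = diff_act (\<theta> e * \<psi> e') F"
        unfolding p_def diff_act_mult[symmetric] by (simp add: mult.commute)
      then show ?thesis using \<psi>(2)[OF e'] by (simp add: diff_act_mult)
    qed
    have "0 = diff_act (\<psi> e') (\<Sum>e\<in>E. cscale (c e) (p e))"
      unfolding zero by (simp add: cpoly_pair.linear_0[OF clinear_diff_act_right])
    also have "\<dots> = (\<Sum>e\<in>E. cscale (c e) (diff_act (\<theta> e) e'))"
      by (simp add: cpoly_pair.linear_sum[OF clinear_diff_act_right]
          cpoly_pair.linear_scale[OF clinear_diff_act_right] swap)
    also have "\<dots> = (\<Sum>e\<in>E. if e = e' then Poly_Mapping.single 0 (c e') else 0)"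
      by (rule sum.cong) (simp_all add: \<theta>_dual[OF e'_form] f_basis[OF e'] cscale_single)
    also have "\<dots> = Poly_Mapping.single 0 (c e')" using e' E(1) by simp
    finally have "Poly_Mapping.lookup (Poly_Mapping.single (0 :: 'a \<Rightarrow>\<^sub>0 nat) (c e')) 0 = 0"
      by (metis lookup_zero)
    then show "c e' = 0" by simp
  qed
  moreover have "cpoly.fin_dim (derivs d F (d - a))"
    using fin_dim_subset_forms[OF X derivs_subset_forms[OF F]] by simp
  ultimately have "card (p ` E) \<le> cpoly.dim (derivs d F (d - a))"
    using cpoly.independent_finite_card_le_dim[OF _ p_mem] by blast
  moreover have "card (p ` E) = card E"
    using \<open>inj_on p E \<and> cpoly.independent (p ` E)\<close> card_image by blast
  ultimately show ?thesis using E(4) by simp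
qed

lemma diff_act_disjoint:
  assumes "\<Theta> \<in> forms X m" "m \<noteq> 0" "G \<in> polys Y" "X \<inter> Y = {}"
  shows "diff_act \<Theta> G = 0"
  using diff_act_restrict_vars[OF assms(3), of \<Theta>] restrict_vars_disjoint[OF assms(1,2,4)]
  by (simp add: cpoly_pair.linear_0[OF clinear_diff_act_left])

lemma dim_derivs_sum:
  assumes A: "finite A" and X: "\<And>i. i \<in> A \<Longrightarrow> finite (X i)" "disjoint_family_on X A"
    and F: "\<And>i. i \<in> A \<Longrightarrow> F i \<in> forms (X i) d" and a: "1 \<le> a" "a < d"
  shows "cpoly.dim (derivs d (\<Sum>i\<in>A. F i) a) = (\<Sum>i\<in>A. cpoly.dim (derivs d (F i) a))"
proof -
  have FX: "F i \<in> polys (X i)" if "i \<in> A" for i using F[OF that] forms_subset_polys by blast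
  have disj: "X i \<inter> X j = {}" if "i \<in> A" "j \<in> A" "i \<noteq> j" for i j
    using X(2) that by (simp add: disjoint_family_on_def)
  have sub: "derivs d (F i) a \<subseteq> forms (X i) a" if "i \<in> A" for i
    using derivs_subset_forms[OF F[OF that]] a by simp
  let ?W = "{\<Sum>i\<in>A. w i |w. \<forall>i\<in>A. w i \<in> derivs d (F i) a}"
  have W: "cpoly.subspace ?W \<and> cpoly.fin_dim ?W \<and> cpoly.dim ?W = (\<Sum>i\<in>A. cpoly.dim (derivs d (F i) a))"
  proof (rule dim_direct_sum[where p = "\<lambda>i. restrict_vars (X i)"])
    show "cpoly.fin_dim (derivs d (F i) a)" if "i \<in> A" for i
      using fin_dim_subset_forms[OF X(1)[OF that] sub[OF that]] .
    show "restrict_vars (X i) w = w" if "i \<in> A" "w \<in> derivs d (F i) a" for i w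
      using restrict_vars_id sub[OF that(1)] that(2) forms_subset_polys by blast
    show "restrict_vars (X i) w = 0" if "i \<in> A" "j \<in> A" "i \<noteq> j" "w \<in> derivs d (F j) a" for i j w
      using restrict_vars_disjoint[of w "X j" a "X i"] sub[OF that(2)] that(4) a disj[OF that(2,1)] that(3)
      by auto
  qed (use A in \<open>simp_all add: subspace_derivs clinear_restrict_vars\<close>)
  have diff_sum: "diff_act \<Theta> (\<Sum>i\<in>A. F i) = (\<Sum>i\<in>A. diff_act \<Theta> (F i))" for \<Theta>
    by (rule cpoly_pair.linear_sum[OF clinear_diff_act_right])
  have "derivs d (\<Sum>i\<in>A. F i) a = ?W"
  proof
    show "derivs d (\<Sum>i\<in>A. F i) a \<subseteq> ?W"
      unfolding derivs_def[of d "\<Sum>i\<in>A. F i"]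
    proof (rule cpoly.span_minimal)
      show "{diff_act (monom_poly s) (\<Sum>i\<in>A. F i) |s. mono_deg s = d - a} \<subseteq> ?W"
      proof clarify
        fix s :: "'b \<Rightarrow>\<^sub>0 nat" assume s: "mono_deg s = d - a"
        have "diff_act (monom_poly s) (F i) \<in> derivs d (F i) a" for i
          unfolding derivs_def using s by (intro cpoly.span_base) blast
        then show "\<exists>w. diff_act (monom_poly s) (\<Sum>i\<in>A. F i) = (\<Sum>i\<in>A. w i) \<and> (\<forall>i\<in>A. w i \<in> derivs d (F i) a)"
          by (intro exI[of _ "\<lambda>i. diff_act (monom_poly s) (F i)"]) (simp add: diff_sum)
      qed
      show "cpoly.subspace ?W" using W by blast
    qed
    have "derivs d (F i) a \<subseteq> derivs d (\<Sum>i\<in>A. F i) a" if i: "i \<in> A" for i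
      unfolding derivs_eq_image[OF FX[OF i]]
    proof clarify
      fix \<Theta> assume \<Theta>: "\<Theta> \<in> forms (X i) (d - a)"
      have "diff_act \<Theta> (F j) = 0" if "j \<in> A - {i}" for j
        using diff_act_disjoint[OF \<Theta> _ FX] disj[OF i] that a by auto
      then have "(\<Sum>j\<in>A - {i}. diff_act \<Theta> (F j)) = 0" by (intro sum.neutral) blast
      then have "diff_act \<Theta> (\<Sum>i\<in>A. F i) = diff_act \<Theta> (F i)"
        using sum.remove[OF A i, of "\<lambda>j. diff_act \<Theta> (F j)"] by (simp add: diff_sum)
      moreover have "\<Theta> \<in> forms UNIV (d - a)" using \<Theta> by (simp add: in_forms_iff)
      moreover have "(\<Sum>i\<in>A. F i) \<in> polys UNIV" by (simp add: in_polys_iff)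
      ultimately show "diff_act \<Theta> (F i) \<in> derivs d (\<Sum>i\<in>A. F i) a"
        unfolding derivs_eq_image[OF \<open>(\<Sum>i\<in>A. F i) \<in> polys UNIV\<close>, of d a]
        by (intro image_eqI[where x = \<Theta>]) simp_all
    qed
    then show "?W \<subseteq> derivs d (\<Sum>i\<in>A. F i) a"
      by (auto intro!: cpoly.subspace_sum[OF subspace_derivs])
  qed
  then show ?thesis using W by simp
qed

section \<open>Unions of schemes in independent variables\<close>

lemma closed_subscheme_embed:
  assumes "closed_subscheme Y Z" "Y \<subseteq> X"
  shows "closed_subscheme X (embed_subscheme X Y Z)"
proof -
  have Z: "ideal Z (poly_ring Y)" "homogeneous Z" using assms(1) by (simp_all add: closed_subscheme_def)
  have "ideal (embed_subscheme X Y Z) (poly_ring X)"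
    unfolding ideal_poly_ring_iff
  proof (intro conjI ballI)
    show "embed_subscheme X Y Z \<subseteq> polys X" by (auto simp: embed_subscheme_def)
    show "0 \<in> embed_subscheme X Y Z"
      using Z(1) by (simp add: embed_subscheme_def ideal_poly_ring_iff cpoly.subspace_0[OF subspace_polys]
        cpoly_pair.linear_0[OF clinear_restrict_vars])
    show "F + G \<in> embed_subscheme X Y Z" if "F \<in> embed_subscheme X Y Z" "G \<in> embed_subscheme X Y Z" for F G
      using that Z(1) by (simp add: embed_subscheme_def ideal_poly_ring_iff cpoly.subspace_add[OF subspace_polys]
        cpoly_pair.linear_add[OF clinear_restrict_vars])
    show "G * F \<in> embed_subscheme X Y Z" if "F \<in> embed_subscheme X Y Z" "G \<in> polys X" for F G
      using that ideal_mult[OF Z(1) _ restrict_vars_in_polys]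
      by (simp add: embed_subscheme_def mult_in_polys restrict_vars_mult)
  qed
  moreover have "homogeneous (embed_subscheme X Y Z)"
    unfolding homogeneous_def
  proof (intro ballI allI)
    fix F m assume F: "F \<in> embed_subscheme X Y Z"
    then have "form_component m F \<in> polys X"
      using form_component_in_forms[of F X m] forms_subset_polys[of X m] by (auto simp: embed_subscheme_def)
    then show "form_component m F \<in> embed_subscheme X Y Z"
      using F homogeneousD[OF Z(2)] by (simp add: embed_subscheme_def restrict_vars_form_component)
  qed
  moreover have "F \<in> embed_subscheme X Y Z"
    if F: "F \<in> polys X" and N: "\<forall>G\<in>forms X N. G * F \<in> embed_subscheme X Y Z" for F N
  proof -
    have "restrict_vars Y F \<in> Z"
    proof (rule closed_subscheme_saturated[OF assms(1) restrict_vars_in_polys])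
      fix G assume G: "G \<in> forms Y N"
      then have "G * F \<in> embed_subscheme X Y Z" using N forms_mono[OF assms(2)] by blast
      moreover have "restrict_vars Y G = G" using G forms_subset_polys restrict_vars_id by blast
      ultimately show "G * restrict_vars Y F \<in> Z" by (simp add: embed_subscheme_def restrict_vars_mult)
    qed
    then show ?thesis using F by (simp add: embed_subscheme_def)
  qed
  ultimately show ?thesis unfolding closed_subscheme_def by blast
qed

lemma closed_subscheme_union:
  assumes "A \<noteq> {}" "\<And>i. i \<in> A \<Longrightarrow> closed_subscheme X (J i)"
  shows "closed_subscheme X (scheme_union A J)"
proof -
  have J: "ideal (J i) (poly_ring X)" "homogeneous (J i)" if "i \<in> A" for i
    using assms(2)[OF that] by (simp_all add: closed_subscheme_def)
  have "ideal (scheme_union A J) (poly_ring X)"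
    using J(1) assms(1) unfolding ideal_poly_ring_iff scheme_union_def by fastforce
  moreover have "homogeneous (scheme_union A J)"
    using J(2) by (simp add: homogeneous_def scheme_union_def)
  moreover have "F \<in> scheme_union A J"
    if "F \<in> polys X" "\<forall>G\<in>forms X N. G * F \<in> scheme_union A J" for F N
    unfolding scheme_union_def
  proof
    fix i assume "i \<in> A"
    then show "F \<in> J i"
      using closed_subscheme_saturated[OF assms(2) that(1), of i N] that(2) by (simp add: scheme_union_def)
  qed
  ultimately show ?thesis unfolding closed_subscheme_def by blast
qed

lemma apolar_union:
  assumes A: "A \<noteq> {}" and X: "\<And>i. i \<in> A \<Longrightarrow> X i \<subseteq> V"
    and F: "\<And>i. i \<in> A \<Longrightarrow> F i \<in> polys (X i)" and Z: "\<And>i. i \<in> A \<Longrightarrow> apolar (X i) (Z i) (F i)"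
  shows "apolar V (scheme_union A (\<lambda>i. embed_subscheme V (X i) (Z i))) (\<Sum>i\<in>A. F i)"
  unfolding apolar_def
proof
  show "closed_subscheme V (scheme_union A (\<lambda>i. embed_subscheme V (X i) (Z i)))"
    using Z X A by (intro closed_subscheme_union closed_subscheme_embed) (simp_all add: apolar_def)
  show "scheme_union A (\<lambda>i. embed_subscheme V (X i) (Z i)) \<subseteq> apolar_ideal V (\<Sum>i\<in>A. F i)"
  proof
    fix \<Theta> assume "\<Theta> \<in> scheme_union A (\<lambda>i. embed_subscheme V (X i) (Z i))"
    then have \<Theta>: "\<Theta> \<in> polys V" "\<And>i. i \<in> A \<Longrightarrow> restrict_vars (X i) \<Theta> \<in> Z i"
      using A by (auto simp: scheme_union_def embed_subscheme_def)
    have "diff_act \<Theta> (F i) = 0" if i: "i \<in> A" for i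
      using \<Theta>(2)[OF i] Z[OF i] diff_act_restrict_vars[OF F[OF i], of \<Theta>]
      by (auto simp: apolar_def apolar_ideal_def)
    then have "diff_act \<Theta> (\<Sum>i\<in>A. F i) = 0"
      by (simp add: cpoly_pair.linear_sum[OF clinear_diff_act_right])
    then show "\<Theta> \<in> apolar_ideal V (\<Sum>i\<in>A. F i)" using \<Theta>(1) by (simp add: apolar_ideal_def)
  qed
qed

subsection \<open>Points of a union\<close>

lemma prime_contains_ideal_of_Inter:
  assumes "finite A" "A \<noteq> {}" "primeideal P (poly_ring X)"
    and "\<And>i. i \<in> A \<Longrightarrow> ideal (J i) (poly_ring X)" "(\<Inter>i\<in>A. J i) \<subseteq> P"
  shows "\<exists>i\<in>A. J i \<subseteq> P"
  using assms(1,2,4,5)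
proof (induction A rule: finite_ne_induct)
  case (insert j A)
  show ?case
  proof (cases "J j \<subseteq> P")
    case False
    then obtain f where f: "f \<in> J j" "f \<notin> P" by blast
    have Jj: "ideal (J j) (poly_ring X)" using insert.prems by simp
    have fX: "f \<in> polys X" using f ideal_subset_polys[OF Jj] by blast
    have "(\<Inter>i\<in>A. J i) \<subseteq> P"
    proof
      fix g assume g: "g \<in> (\<Inter>i\<in>A. J i)"
      obtain i where "i \<in> A" using insert.hyps by blast
      then have gX: "g \<in> polys X" using g ideal_subset_polys[of "J i" X] insert.prems(1)[of i] by blast
      have "g * f \<in> J j" using ideal_mult[OF Jj f(1) gX] .
      moreover have "f * g \<in> J i" if "i \<in> A" for i
        using ideal_mult[OF insert.prems(1)[of i] _ fX] g that by blast
      ultimately have "f * g \<in> P" using insert.prems(2) by (auto simp: mult.commute)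
      then show "g \<in> P" using assms(3) f(2) fX gX unfolding primeideal_poly_ring_iff by blast
    qed
    then show ?thesis using insert.IH insert.prems(1) by blast
  qed blast
qed blast

text \<open>The points of the linear subspace with the variables \<open>Y\<close> correspond to homogeneous primes of the
  smaller polynomial ring: a prime \<open>P\<close> that contains the variables outside \<open>Y\<close> is determined by its
  trace on \<open>polys Y\<close>. Conversely, \<open>scheme_point_embed\<close> below takes the preimage of a prime.\<close>

lemma scheme_point_trace:
  assumes P: "P \<in> scheme_points X Z'" and YX: "Y \<subseteq> X" and Z: "closed_subscheme Y Z"
    and sub: "embed_subscheme X Y Z \<subseteq> P"
  shows "P \<inter> polys Y \<in> scheme_points Y Z"
    and "\<And>F. F \<in> polys X \<Longrightarrow> F \<in> P \<longleftrightarrow> restrict_vars Y F \<in> P"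
proof -
  have prime: "primeideal P (poly_ring X)" "homogeneous P" "\<not> forms X 1 \<subseteq> P"
    using P by (auto simp: scheme_points_def)
  have Pi: "ideal P (poly_ring X)" using prime(1) by (simp add: primeideal_poly_ring_iff)
  have Psub: "cpoly.subspace P" using subspace_ideal[OF Pi] .
  have Zi: "ideal Z (poly_ring Y)" using closed_subscheme_ideal[OF Z] .
  have YX': "polys Y \<subseteq> polys X" using polys_mono[OF YX] .
  show iff: "F \<in> P \<longleftrightarrow> restrict_vars Y F \<in> P" if F: "F \<in> polys X" for F
  proof -
    have rX: "restrict_vars Y F \<in> polys X" using restrict_vars_in_polys YX' by blast
    have "restrict_vars Y (F - restrict_vars Y F) = 0"
      by (simp add: cpoly_pair.linear_diff[OF clinear_restrict_vars] restrict_vars_id[OF restrict_vars_in_polys])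
    then have "F - restrict_vars Y F \<in> embed_subscheme X Y Z"
      using cpoly.subspace_diff[OF subspace_polys F rX] Zi
      by (simp add: embed_subscheme_def ideal_poly_ring_iff)
    then have diff: "F - restrict_vars Y F \<in> P" using sub by blast
    show ?thesis
    proof
      assume "F \<in> P"
      from cpoly.subspace_diff[OF Psub this diff] show "restrict_vars Y F \<in> P" by simp
    next
      assume "restrict_vars Y F \<in> P"
      from cpoly.subspace_add[OF Psub diff this] show "F \<in> P" by simp
    qed
  qed
  have "primeideal (P \<inter> polys Y) (poly_ring Y)"
    unfolding primeideal_poly_ring_iff
  proof (intro conjI ballI impI)
    show "ideal (P \<inter> polys Y) (poly_ring Y)"
      unfolding ideal_poly_ring_iff
    proof (intro conjI ballI)
      show "0 \<in> P \<inter> polys Y" using cpoly.subspace_0[OF Psub] cpoly.subspace_0[OF subspace_polys] by simp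
      show "F + G \<in> P \<inter> polys Y" if "F \<in> P \<inter> polys Y" "G \<in> P \<inter> polys Y" for F G
        using that cpoly.subspace_add[OF Psub] cpoly.subspace_add[OF subspace_polys[of Y]] by simp
      show "G * F \<in> P \<inter> polys Y" if "F \<in> P \<inter> polys Y" "G \<in> polys Y" for F G
        using that ideal_mult[OF Pi, of F G] YX' mult_in_polys[of G Y F] by auto
    qed simp
    show "1 \<notin> P \<inter> polys Y" using prime(1) by (simp add: primeideal_poly_ring_iff)
    show "F \<in> P \<inter> polys Y \<or> G \<in> P \<inter> polys Y"
      if "F \<in> polys Y" "G \<in> polys Y" "F * G \<in> P \<inter> polys Y" for F G
      using that prime(1) YX' unfolding primeideal_poly_ring_iff by blast
  qed
  moreover have "homogeneous (P \<inter> polys Y)"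
    using homogeneousD[OF prime(2)] form_component_in_forms[of _ Y] forms_subset_polys[of Y]
    unfolding homogeneous_def by blast
  moreover have "\<not> forms Y 1 \<subseteq> P \<inter> polys Y"
  proof
    assume "forms Y 1 \<subseteq> P \<inter> polys Y"
    then have "forms X 1 \<subseteq> P"
      using iff forms_subset_polys[of X 1] restrict_vars_in_forms[of _ X 1 Y] by blast
    then show False using prime(3) by blast
  qed
  moreover have "Z \<subseteq> P \<inter> polys Y"
  proof
    fix F assume F: "F \<in> Z"
    then have FY: "F \<in> polys Y" using ideal_subset_polys[OF Zi] by blast
    then have "F \<in> embed_subscheme X Y Z"
      using F YX' restrict_vars_id[OF FY] by (auto simp: embed_subscheme_def)
    then show "F \<in> P \<inter> polys Y" using sub FY by blast
  qed
  ultimately show "P \<inter> polys Y \<in> scheme_points Y Z" by (simp add: scheme_points_def)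
qed

lemma scheme_point_embed:
  assumes Q: "Q \<in> scheme_points Y Z" and YX: "Y \<subseteq> X"
  shows "embed_subscheme X Y Q \<in> scheme_points X (embed_subscheme X Y Z)"
proof -
  have prime: "primeideal Q (poly_ring Y)" "homogeneous Q" "\<not> forms Y 1 \<subseteq> Q" "Z \<subseteq> Q"
    using Q by (auto simp: scheme_points_def)
  have Qi: "ideal Q (poly_ring Y)" using prime(1) by (simp add: primeideal_poly_ring_iff)
  have QP: "F \<in> Q \<or> G \<in> Q" if "F \<in> polys Y" "G \<in> polys Y" "F * G \<in> Q" for F G
    using prime(1) that unfolding primeideal_poly_ring_iff by blast
  (* A prime is saturated, as it does not contain the powers of some linear form l. *)
  have "closed_subscheme Y Q"
    unfolding closed_subscheme_def
  proof (intro conjI ballI impI Qi prime(2))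
    fix F assume F: "F \<in> polys Y" and "\<exists>N. \<forall>G\<in>forms Y N. G * F \<in> Q"
    then obtain N where N: "\<forall>G\<in>forms Y N. G * F \<in> Q" by blast
    obtain l where l: "l \<in> forms Y 1" "l \<notin> Q" using prime(3) by blast
    have lY: "l \<in> polys Y" using l(1) forms_subset_polys by blast
    have "l ^ n \<in> forms Y n \<and> l ^ n \<in> polys Y \<and> l ^ n \<notin> Q" for n
    proof (induction n)
      case 0
      have "1 \<in> forms Y 0" unfolding one_eq_monom_poly monom_poly_in_forms_iff by simp
      then show ?case using prime(1) one_in_polys by (simp add: primeideal_poly_ring_iff)
    next
      case (Suc n)
      then show ?case
        using mult_in_forms[OF l(1), of "l ^ n" n] mult_in_polys[OF lY, of "l ^ n"] QP[OF lY, of "l ^ n"] l(2)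
        by auto
    qed
    then show "F \<in> Q" using N QP[of "l ^ N" F] F by blast
  qed
  then have closed: "closed_subscheme X (embed_subscheme X Y Q)"
    using closed_subscheme_embed YX by blast
  have "primeideal (embed_subscheme X Y Q) (poly_ring X)"
    unfolding primeideal_poly_ring_iff
  proof (intro conjI ballI impI)
    show "ideal (embed_subscheme X Y Q) (poly_ring X)" using closed_subscheme_ideal[OF closed] .
    show "1 \<notin> embed_subscheme X Y Q"
      using prime(1) by (simp add: embed_subscheme_def restrict_vars_one primeideal_poly_ring_iff)
    show "F \<in> embed_subscheme X Y Q \<or> G \<in> embed_subscheme X Y Q"
      if "F \<in> polys X" "G \<in> polys X" "F * G \<in> embed_subscheme X Y Q" for F G
      using that QP[OF restrict_vars_in_polys restrict_vars_in_polys, of F G]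
      by (auto simp: embed_subscheme_def restrict_vars_mult)
  qed
  moreover have "homogeneous (embed_subscheme X Y Q)"
    using closed by (simp add: closed_subscheme_def)
  moreover have "\<not> forms X 1 \<subseteq> embed_subscheme X Y Q"
  proof
    assume sub: "forms X 1 \<subseteq> embed_subscheme X Y Q"
    have "forms Y 1 \<subseteq> Q"
    proof
      fix l assume l: "l \<in> forms Y 1"
      then have "l \<in> embed_subscheme X Y Q" using sub forms_mono[OF YX] by blast
      moreover have "restrict_vars Y l = l" using l forms_subset_polys restrict_vars_id by blast
      ultimately show "l \<in> Q" by (simp add: embed_subscheme_def)
    qed
    then show False using prime(3) by blast
  qed
  moreover have "embed_subscheme X Y Z \<subseteq> embed_subscheme X Y Q"
    using prime(4) by (auto simp: embed_subscheme_def)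
  ultimately show ?thesis by (simp add: scheme_points_def)
qed

lemma zero_dimensional_union:
  assumes A: "finite A" "A \<noteq> {}" and X: "\<And>i. i \<in> A \<Longrightarrow> X i \<subseteq> V"
    and Z: "\<And>i. i \<in> A \<Longrightarrow> closed_subscheme (X i) (Z i)" "\<And>i. i \<in> A \<Longrightarrow> zero_dimensional (X i) (Z i)"
  shows "zero_dimensional V (scheme_union A (\<lambda>i. embed_subscheme V (X i) (Z i)))"
proof -
  let ?J = "\<lambda>i. embed_subscheme V (X i) (Z i)"
  have J: "ideal (?J i) (poly_ring V)" if "i \<in> A" for i
    using closed_subscheme_ideal[OF closed_subscheme_embed[OF Z(1) X]] that by blast
  have "scheme_points V (scheme_union A ?J) \<noteq> {}"
  proof -
    obtain i where i: "i \<in> A" using A by blast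
    then obtain Q where "Q \<in> scheme_points (X i) (Z i)"
      using Z(2) unfolding zero_dimensional_def by blast
    then have "embed_subscheme V (X i) Q \<in> scheme_points V (?J i)" using scheme_point_embed X[OF i] by blast
    moreover have "scheme_union A ?J \<subseteq> ?J i" using i by (auto simp: scheme_union_def)
    ultimately have "embed_subscheme V (X i) Q \<in> scheme_points V (scheme_union A ?J)"
      by (auto simp: scheme_points_def)
    then show ?thesis by blast
  qed
  moreover have "P = Q"
    if P: "P \<in> scheme_points V (scheme_union A ?J)" and Q: "Q \<in> scheme_points V (scheme_union A ?J)"
      and PQ: "P \<subseteq> Q" for P Q
  proof -
    have "primeideal P (poly_ring V)" "(\<Inter>i\<in>A. ?J i) \<subseteq> P"
      using P by (simp_all add: scheme_points_def scheme_union_def)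
    then obtain i where i: "i \<in> A" "?J i \<subseteq> P"
      using prime_contains_ideal_of_Inter[OF A, of P V ?J] J by blast
    note traceP = scheme_point_trace[OF P X[OF i(1)] Z(1)[OF i(1)] i(2)]
    have JQ: "?J i \<subseteq> Q" using i(2) PQ by blast
    note traceQ = scheme_point_trace[OF Q X[OF i(1)] Z(1)[OF i(1)] JQ]
    have eq: "P \<inter> polys (X i) = Q \<inter> polys (X i)"
    proof -
      have "\<forall>P\<in>scheme_points (X i) (Z i). \<forall>Q\<in>scheme_points (X i) (Z i). P \<subseteq> Q \<longrightarrow> P = Q"
        using Z(2)[OF i(1)] by (simp add: zero_dimensional_def)
      from this[rule_format, OF traceP(1) traceQ(1)] show ?thesis using PQ by auto
    qed
    have "F \<in> P" if F: "F \<in> Q" for F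
    proof -
      have FV: "F \<in> polys V"
        using F Q ideal_subset_polys by (auto simp: scheme_points_def primeideal_poly_ring_iff)
      then have "restrict_vars (X i) F \<in> Q \<inter> polys (X i)"
        using F traceQ(2) restrict_vars_in_polys by blast
      then show ?thesis using eq traceP(2)[OF FV] by blast
    qed
    then show ?thesis using PQ by blast
  qed
  ultimately show ?thesis unfolding zero_dimensional_def by blast
qed

subsection \<open>Additivity of the degree\<close>

text \<open>In positive degree the parts of a form in the variables \<open>X i\<close> can be prescribed
  independently; what remains is the kernel of the sum of the restrictions, spanned by the monomials
  that are not in the variables of a single \<open>X i\<close>.\<close>

lemma dim_forms_with_restrictions:
  assumes A: "finite A" and X: "\<And>i. i \<in> A \<Longrightarrow> X i \<subseteq> V" "disjoint_family_on X A" "finite V"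
    and U: "\<And>i. i \<in> A \<Longrightarrow> cpoly.subspace (U i)" "\<And>i. i \<in> A \<Longrightarrow> U i \<subseteq> forms (X i) m"
    and m: "m \<noteq> 0"
  shows "cpoly.dim {\<Theta> \<in> forms V m. \<forall>i\<in>A. restrict_vars (X i) \<Theta> \<in> U i} =
    cpoly.dim {\<Theta> \<in> forms V m. (\<Sum>i\<in>A. restrict_vars (X i) \<Theta>) = 0} + (\<Sum>i\<in>A. cpoly.dim (U i))"
proof -
  have disj: "X i \<inter> X j = {}" if "i \<in> A" "j \<in> A" "i \<noteq> j" for i j
    using X(2) that by (simp add: disjoint_family_on_def)
  have own: "restrict_vars (X i) w = w" if "i \<in> A" "w \<in> U i" for i w
    using restrict_vars_id U(2)[OF that(1)] that(2) forms_subset_polys by blast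
  have other: "restrict_vars (X i) w = 0" if "i \<in> A" "j \<in> A" "i \<noteq> j" "w \<in> forms (X j) m" for i j w
    using restrict_vars_disjoint[OF that(4) m disj[OF that(2,1)]] that(3) by simp
  let ?W = "{\<Sum>i\<in>A. w i |w. \<forall>i\<in>A. w i \<in> U i}"
  have W: "cpoly.dim ?W = (\<Sum>i\<in>A. cpoly.dim (U i))"
  proof -
    have "cpoly.subspace ?W \<and> cpoly.fin_dim ?W \<and> cpoly.dim ?W = (\<Sum>i\<in>A. cpoly.dim (U i))"
    proof (rule dim_direct_sum[where p = "\<lambda>i. restrict_vars (X i)"])
      show "cpoly.fin_dim (U i)" if "i \<in> A" for i
        using fin_dim_subset_forms[OF X(3), of "U i" m] U(2)[OF that] forms_mono[OF X(1)[OF that], of m] by blast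
      show "restrict_vars (X i) w = 0" if "i \<in> A" "j \<in> A" "i \<noteq> j" "w \<in> U j" for i j w
        using other[OF that(1-3)] U(2)[OF that(2)] that(4) by blast
    qed (use A U(1) own in \<open>simp_all add: clinear_restrict_vars\<close>)
    then show ?thesis by blast
  qed
  define S where "S = {\<Theta> \<in> forms V m. \<forall>i\<in>A. restrict_vars (X i) \<Theta> \<in> U i}"
  define R where "R \<Theta> = (\<Sum>i\<in>A. restrict_vars (X i) \<Theta>)" for \<Theta>
  have linR: "clinear R"
    unfolding R_def by (rule cpoly_pair.linear_compose_sum) (simp add: clinear_restrict_vars)
  have S: "cpoly.subspace S"
    unfolding cpoly.subspace_def S_def
    by (auto simp: cpoly_pair.linear_add[OF clinear_restrict_vars] cpoly_pair.linear_scale[OF clinear_restrict_vars]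
      cpoly_pair.linear_0[OF clinear_restrict_vars]
      intro: cpoly.subspace_0 cpoly.subspace_add cpoly.subspace_scale subspace_forms U(1))
  have finS: "cpoly.fin_dim S" using fin_dim_subset_forms[OF X(3), of S m] by (auto simp: S_def)
  have pick: "restrict_vars (X j) (\<Sum>i\<in>A. w i) = w j"
    if j: "j \<in> A" and w: "\<forall>i\<in>A. w i \<in> forms (X i) m" for j w
  proof -
    have "restrict_vars (X j) (\<Sum>i\<in>A. w i) = (\<Sum>i\<in>A. restrict_vars (X j) (w i))"
      by (rule cpoly_pair.linear_sum[OF clinear_restrict_vars])
    also have "\<dots> = (\<Sum>i\<in>A. if i = j then w j else 0)"
    proof (rule sum.cong[OF refl])
      fix i assume i: "i \<in> A"
      show "restrict_vars (X j) (w i) = (if i = j then w j else 0)"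
        using other[OF j i] w i restrict_vars_id[of "w j" "X j"] forms_subset_polys[of "X j" m] by auto
    qed
    also have "\<dots> = w j" using j A by simp
    finally show ?thesis .
  qed
  have "R ` S = ?W"
  proof
    show "R ` S \<subseteq> ?W"
    proof
      fix y assume "y \<in> R ` S"
      then obtain \<Theta> where "\<Theta> \<in> S" "y = R \<Theta>" by blast
      then show "y \<in> ?W"
        unfolding R_def S_def by (intro CollectI exI[of _ "\<lambda>i. restrict_vars (X i) \<Theta>"]) simp
    qed
    show "?W \<subseteq> R ` S"
    proof
      fix y assume "y \<in> ?W"
      then obtain w where w: "y = (\<Sum>i\<in>A. w i)" "\<forall>i\<in>A. w i \<in> U i" by blast
      have wf: "\<forall>i\<in>A. w i \<in> forms (X i) m" using w(2) U(2) by blast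
      have "y \<in> forms V m"
        unfolding w(1) using wf forms_mono[OF X(1)] by (intro cpoly.subspace_sum[OF subspace_forms]) blast
      moreover have r: "restrict_vars (X j) y = w j" if "j \<in> A" for j
        unfolding w(1) using pick[OF that wf] .
      ultimately have "y \<in> S" using w(2) by (simp add: S_def)
      moreover have "y = R y" unfolding R_def using r by (simp add: w(1))
      ultimately show "y \<in> R ` S" by blast
    qed
  qed
  moreover have "{\<Theta> \<in> S. R \<Theta> = 0} = {\<Theta> \<in> forms V m. (\<Sum>i\<in>A. restrict_vars (X i) \<Theta>) = 0}"
  proof
    show "{\<Theta> \<in> forms V m. (\<Sum>i\<in>A. restrict_vars (X i) \<Theta>) = 0} \<subseteq> {\<Theta> \<in> S. R \<Theta> = 0}"
    proof clarify
      fix \<Theta> assume \<Theta>: "\<Theta> \<in> forms V m" "(\<Sum>i\<in>A. restrict_vars (X i) \<Theta>) = 0"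
      have "restrict_vars (X j) \<Theta> = 0" if j: "j \<in> A" for j
        using pick[OF j, of "\<lambda>i. restrict_vars (X i) \<Theta>"] restrict_vars_in_forms[OF \<Theta>(1)]
        unfolding \<Theta>(2) cpoly_pair.linear_0[OF clinear_restrict_vars] by simp
      then show "\<Theta> \<in> S \<and> R \<Theta> = 0"
        using \<Theta> cpoly.subspace_0[OF U(1)] by (simp add: S_def R_def)
    qed
  qed (auto simp: S_def R_def)
  ultimately show ?thesis
    using cpoly_pair.dim_kernel_plus_image[OF linR S finS] W by (simp add: S_def)
qed

lemma hilbert_function_union:
  assumes A: "finite A" "A \<noteq> {}" and X: "\<And>i. i \<in> A \<Longrightarrow> X i \<subseteq> V" "disjoint_family_on X A" "finite V"
    and Z: "\<And>i. i \<in> A \<Longrightarrow> closed_subscheme (X i) (Z i)" and m: "m \<noteq> 0"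
  shows "hilbert_function V (scheme_union A (\<lambda>i. embed_subscheme V (X i) (Z i))) m =
    (\<Sum>i\<in>A. hilbert_function (X i) (Z i) m)"
proof -
  let ?\<kappa> = "cpoly.dim {\<Theta> \<in> forms V m. (\<Sum>i\<in>A. restrict_vars (X i) \<Theta>) = 0}"
  have "{\<Theta> \<in> forms V m. \<forall>i\<in>A. restrict_vars (X i) \<Theta> \<in> forms (X i) m} = forms V m"
    using restrict_vars_in_forms by blast
  then have 1: "cpoly.dim (forms V m) = ?\<kappa> + (\<Sum>i\<in>A. cpoly.dim (forms (X i) m))"
    using dim_forms_with_restrictions[OF A(1) X subspace_forms order_refl m] by simp
  have "scheme_union A (\<lambda>i. embed_subscheme V (X i) (Z i)) \<inter> forms V m =
      {\<Theta> \<in> forms V m. \<forall>i\<in>A. restrict_vars (X i) \<Theta> \<in> Z i \<inter> forms (X i) m}"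
    using restrict_vars_in_forms[of _ V m] forms_subset_polys[of V m] A(2)
    by (auto simp: scheme_union_def embed_subscheme_def)
  moreover have "cpoly.subspace (Z i \<inter> forms (X i) m)" if "i \<in> A" for i
    using cpoly.subspace_inter[OF subspace_ideal[OF closed_subscheme_ideal[OF Z[OF that]]] subspace_forms] .
  ultimately have 2: "cpoly.dim (scheme_union A (\<lambda>i. embed_subscheme V (X i) (Z i)) \<inter> forms V m) =
      ?\<kappa> + (\<Sum>i\<in>A. cpoly.dim (Z i \<inter> forms (X i) m))"
    using dim_forms_with_restrictions[OF A(1) X, of "\<lambda>i. Z i \<inter> forms (X i) m" m] m by simp
  have "cpoly.dim (Z i \<inter> forms (X i) m) \<le> cpoly.dim (forms (X i) m)" if "i \<in> A" for i
    using fin_dim_forms[OF finite_subset[OF X(1)[OF that] X(3)]] by (intro cpoly.dim_mono_fin_dim) auto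
  then show ?thesis
    unfolding hilbert_function_def 1 2 by (simp add: sum_subtractf_nat)
qed

lemma has_degree_union:
  assumes A: "finite A" "A \<noteq> {}" and X: "\<And>i. i \<in> A \<Longrightarrow> X i \<subseteq> V" "disjoint_family_on X A" "finite V"
    and Z: "\<And>i. i \<in> A \<Longrightarrow> closed_subscheme (X i) (Z i)" "\<And>i. i \<in> A \<Longrightarrow> has_degree (X i) (Z i) (r i)"
  shows "has_degree V (scheme_union A (\<lambda>i. embed_subscheme V (X i) (Z i))) (\<Sum>i\<in>A. r i)"
proof -
  have "\<forall>\<^sub>F m in sequentially. \<forall>i\<in>A. hilbert_function (X i) (Z i) m = r i"
    using Z(2) A(1) by (simp add: has_degree_def eventually_ball_finite_distrib)
  then show ?thesis
    unfolding has_degree_def using eventually_gt_at_top[of 0]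
  proof eventually_elim
    case (elim m)
    then show ?case using hilbert_function_union[OF A X Z(1), of m] by simp
  qed
qed

section \<open>Minimal apolar schemes of a sum\<close>

lemma lookup_0_restrict_vars: "Poly_Mapping.lookup (restrict_vars Y F) 0 = Poly_Mapping.lookup F 0"
  by (simp add: lookup_restrict_vars)

lemma restrict_vars_disjoint_constant:
  assumes "F \<in> polys X" "X \<inter> Y = {}"
  shows "restrict_vars Y F = Poly_Mapping.single 0 (Poly_Mapping.lookup F 0)"
proof (rule poly_mapping_eqI)
  fix t
  have "t = 0" if "Poly_Mapping.keys t \<subseteq> Y" "Poly_Mapping.lookup F t \<noteq> 0"
  proof -
    have "Poly_Mapping.keys t \<subseteq> X" using that(2) assms(1) by (simp add: in_polys_iff)
    then have "Poly_Mapping.keys t = {}" using that(1) assms(2) by blast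
    then show ?thesis by simp
  qed
  then show "Poly_Mapping.lookup (restrict_vars Y F) t =
      Poly_Mapping.lookup (Poly_Mapping.single 0 (Poly_Mapping.lookup F 0)) t"
    by (auto simp: lookup_restrict_vars lookup_single when_def)
qed

text \<open>If an element of a homogeneous ideal had a nonzero constant term, then the ideal would contain
  \<open>1\<close>, which does not annihilate \<open>F\<close>.\<close>

lemma apolar_lookup_0:
  assumes Z: "apolar X Z F" and F: "F \<noteq> 0" and \<Theta>: "\<Theta> \<in> Z"
  shows "Poly_Mapping.lookup \<Theta> 0 = 0"
proof (rule ccontr)
  assume c: "Poly_Mapping.lookup \<Theta> 0 \<noteq> 0"
  have eq: "cscale (Poly_Mapping.lookup \<Theta> 0) (monom_poly 0) =
      Poly_Mapping.single 0 (Poly_Mapping.lookup \<Theta> 0)"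
    by (simp only: cscale_single mult_1_right)
  have "cscale (Poly_Mapping.lookup \<Theta> 0) (monom_poly 0) \<in> Z"
    unfolding eq form_component_zero[symmetric]
    using homogeneousD[of Z \<Theta> 0] Z \<Theta> by (simp add: apolar_def closed_subscheme_def)
  then have "cscale (Poly_Mapping.lookup \<Theta> 0) (monom_poly 0) \<in> apolar_ideal X F"
    using Z unfolding apolar_def by blast
  then have "diff_act (cscale (Poly_Mapping.lookup \<Theta> 0) (monom_poly 0)) F = 0"
    unfolding apolar_ideal_def by blast
  then have "cscale (Poly_Mapping.lookup \<Theta> 0) (diff_act (monom_poly 0) F) = 0"
    by (simp only: cpoly_pair.linear_scale[OF clinear_diff_act_left])
  moreover have "diff_act (monom_poly 0) F = F"
  proof (rule clinear_eqI[OF clinear_diff_act_right clinear_id])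
    fix t :: "'a \<Rightarrow>\<^sub>0 nat"
    have "diff_coeff 0 t = 1" by (simp add: diff_coeff_def)
    then show "diff_act (monom_poly 0) (monom_poly t) = monom_poly t"
      unfolding diff_act_monom_poly by simp
  qed
  ultimately show False using c F by simp
qed

text \<open>The ideal of an apolar scheme of least degree agrees in degree \<open>a\<close> with the apolar ideal, by
  comparison of dimensions. The latter contains the mixed monomials, those with variables from two
  different \<open>X i\<close>. As the ideal of the scheme is saturated and \<open>2 \<le> a\<close>, it contains the mixed
  monomials of all degrees.\<close>

lemma apolar_decomposition:
  fixes X :: "'i \<Rightarrow> 'v set" and F :: "'i \<Rightarrow> 'v cpoly"
  assumes A: "finite A" "A \<noteq> {}" and X: "\<And>i. i \<in> A \<Longrightarrow> finite (X i)" "disjoint_family_on X A"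
    and F: "\<And>i. i \<in> A \<Longrightarrow> F i \<in> forms (X i) d" "\<And>i. i \<in> A \<Longrightarrow> F i \<noteq> 0"
    and a: "2 \<le> a" "a < d"
    and Z: "apolar (\<Union>i\<in>A. X i) Z (\<Sum>i\<in>A. F i)"
    and deg: "has_degree (\<Union>i\<in>A. X i) Z (cpoly.dim (derivs d (\<Sum>i\<in>A. F i) a))"
  shows "\<exists>Zi. (\<forall>i\<in>A. apolar (X i) (Zi i) (F i)) \<and>
    Z = scheme_union A (\<lambda>i. embed_subscheme (\<Union>i\<in>A. X i) (X i) (Zi i))"
proof -
  define V where "V = (\<Union>i\<in>A. X i)"
  define G where "G = (\<Sum>i\<in>A. F i)"
  have XV: "X i \<subseteq> V" if "i \<in> A" for i using that by (auto simp: V_def)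
  have finV: "finite V" using A X by (simp add: V_def)
  have disj: "X i \<inter> X j = {}" if "i \<in> A" "j \<in> A" "i \<noteq> j" for i j
    using X(2) that by (simp add: disjoint_family_on_def)
  have FX: "F i \<in> polys (X i)" if "i \<in> A" for i using F(1)[OF that] forms_subset_polys by blast
  have G: "G \<in> forms V d"
    unfolding G_def using F(1) forms_mono[OF XV] by (intro cpoly.subspace_sum[OF subspace_forms]) blast
  then have GV: "G \<in> polys V" using forms_subset_polys by blast
  have act_G: "diff_act \<Theta> G = (\<Sum>i\<in>A. diff_act \<Theta> (F i))" for \<Theta>
    unfolding G_def by (rule cpoly_pair.linear_sum[OF clinear_diff_act_right])
  have act_G_part: "diff_act \<Theta> G = diff_act \<Theta> (F i)"
    if i: "i \<in> A" and \<Theta>: "\<Theta> \<in> polys (X i)" "Poly_Mapping.lookup \<Theta> 0 = 0" for i \<Theta>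
  proof -
    have "diff_act \<Theta> (F j) = 0" if j: "j \<in> A - {i}" for j
    proof -
      have "restrict_vars (X j) \<Theta> = 0"
        using restrict_vars_disjoint_constant[OF \<Theta>(1), of "X j"] disj[OF i, of j] j \<Theta>(2) by auto
      then show ?thesis
        using diff_act_restrict_vars[OF FX, of j \<Theta>] j
        by (simp add: cpoly_pair.linear_0[OF clinear_diff_act_left])
    qed
    then have "(\<Sum>j\<in>A - {i}. diff_act \<Theta> (F j)) = 0" by (intro sum.neutral) blast
    then show ?thesis
      using sum.remove[OF A(1) i, of "\<lambda>j. diff_act \<Theta> (F j)"] by (simp add: act_G)
  qed
  have top: "diff_act (monom_poly t) G \<noteq> 0" if i: "i \<in> A" and t: "t \<in> Poly_Mapping.keys (F i)" for i t
  proof -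
    have t': "Poly_Mapping.keys t \<subseteq> X i" "mono_deg t = d"
      using F(1)[OF i] t by (auto simp: in_forms_iff in_keys_iff)
    then have "t \<noteq> 0" using a by auto
    then have "diff_act (monom_poly t) G = diff_act (monom_poly t) (F i)"
      using act_G_part[OF i, of "monom_poly t"] t'(1)
      by (simp add: monom_poly_in_polys_iff lookup_single when_def)
    also have "\<dots> = Poly_Mapping.single 0 (Poly_Mapping.lookup (F i) t * of_nat (diff_coeff t t))"
      using diff_act_monom_poly_form F(1)[OF i] t'(2) by blast
    finally have "Poly_Mapping.lookup (diff_act (monom_poly t) G) 0 \<noteq> 0"
      using t diff_coeff_self_nonzero[of t] by (simp add: in_keys_iff)
    then show ?thesis by auto
  qed
  have G0: "G \<noteq> 0"
  proof -
    obtain i where i: "i \<in> A" using A(2) by blast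
    have "Poly_Mapping.keys (F i) \<noteq> {}" using F(2)[OF i] by simp
    then obtain t where "t \<in> Poly_Mapping.keys (F i)" by blast
    then show ?thesis using top[OF i] by (auto simp: cpoly_pair.linear_0[OF clinear_diff_act_right])
  qed
  have ZG: "apolar V Z G" using Z by (simp add: V_def G_def)
  have Zc: "closed_subscheme V Z" and Zperp: "Z \<subseteq> apolar_ideal V G" using ZG by (simp_all add: apolar_def)
  have Zi: "ideal Z (poly_ring V)" using closed_subscheme_ideal[OF Zc] .
  have Zsub: "cpoly.subspace Z" using subspace_ideal[OF Zi] .
  have ZV: "Z \<subseteq> polys V" using ideal_subset_polys[OF Zi] .
  have const: "Poly_Mapping.lookup \<Theta> 0 = 0" if "\<Theta> \<in> Z" for \<Theta> using apolar_lookup_0[OF ZG G0 that] .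
  have saturated: "\<Theta> \<in> Z"
    if \<Theta>: "\<Theta> \<in> polys V" and N: "\<And>s. Poly_Mapping.keys s \<subseteq> V \<Longrightarrow> mono_deg s = N \<Longrightarrow> monom_poly s * \<Theta> \<in> Z"
    for \<Theta> N
  proof (rule closed_subscheme_saturated[OF Zc \<Theta>])
    fix \<Psi> assume \<Psi>: "\<Psi> \<in> forms V N"
    show "\<Psi> * \<Theta> \<in> Z"
    proof (rule clinear_in_subspace[OF clinear_mult_right Zsub])
      fix s assume "s \<in> Poly_Mapping.keys \<Psi>"
      then show "monom_poly s * \<Theta> \<in> Z" using \<Psi> by (intro N) (auto simp: in_forms_iff in_keys_iff)
    qed
  qed

  (* The Hilbert function of Z at a is at most dim (derivs d G a), hence at most
     dim (derivs d G (d - a)), which is the value for the apolar ideal. *)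
  have degree_a: "Z \<inter> forms V a = apolar_ideal V G \<inter> forms V a"
  proof (rule cpoly.subspace_eq_if_dim_le)
    show "cpoly.subspace (Z \<inter> forms V a)" using cpoly.subspace_inter[OF Zsub subspace_forms] .
    show "Z \<inter> forms V a \<subseteq> apolar_ideal V G \<inter> forms V a" using Zperp by blast
    show "cpoly.fin_dim (apolar_ideal V G \<inter> forms V a)" using fin_dim_subset_forms[OF finV] by blast
    have "hilbert_function V Z a \<le> cpoly.dim (derivs d G a)"
      using hilbert_function_le_degree[OF Zc finV] deg by (simp add: V_def G_def)
    also have "\<dots> \<le> cpoly.dim (derivs d G (d - a))"
      using dim_derivs_symmetric_le[OF G finV] a by simp
    finally have "hilbert_function V Z a \<le> cpoly.dim (derivs d G (d - a))" .
    then show "cpoly.dim (apolar_ideal V G \<inter> forms V a) \<le> cpoly.dim (Z \<inter> forms V a)"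
      using dim_derivs_plus_dim_apolar[OF GV finV, of d "d - a"] a
      unfolding hilbert_function_def by simp
  qed

  have pair: "monom_poly (Poly_Mapping.single u 1 + Poly_Mapping.single v 1) \<in> Z"
    if ij: "i \<in> A" "j \<in> A" "i \<noteq> j" and uv: "u \<in> X i" "v \<in> X j" for i j u v
  proof -
    let ?p = "Poly_Mapping.single u 1 + Poly_Mapping.single v (1::nat)"
    have keys: "Poly_Mapping.keys ?p = {u, v}" by (auto simp: keys_add_nat)
    have pV: "Poly_Mapping.keys ?p \<subseteq> V" unfolding keys using uv XV[OF ij(1)] XV[OF ij(2)] by blast
    have "diff_act (monom_poly ?p) (F l) = 0" if l: "l \<in> A" for l
    proof -
      have "\<not> Poly_Mapping.keys ?p \<subseteq> X l"
        unfolding keys using disj[OF ij(1) l] disj[OF ij(2) l] ij(3) uv by blast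
      then show ?thesis
        using diff_act_restrict_vars[OF FX[OF l], of "monom_poly ?p"]
        by (simp add: restrict_vars_monom_poly cpoly_pair.linear_0[OF clinear_diff_act_left])
    qed
    then have kill: "diff_act (monom_poly ?p) G = 0" by (simp add: act_G)
    show ?thesis
    proof (rule saturated)
      show "monom_poly ?p \<in> polys V" using pV by (simp only: monom_poly_in_polys_iff)
      fix s assume s: "Poly_Mapping.keys s \<subseteq> V" "mono_deg s = a - 2"
      have "mono_deg (s + ?p) = a" using s(2) a(1) by (simp add: mono_deg_add)
      moreover have "Poly_Mapping.keys (s + ?p) \<subseteq> V" using s(1) pV keys_add_nat[of s ?p] by blast
      ultimately have "monom_poly (s + ?p) \<in> forms V a" by (simp only: monom_poly_in_forms_iff)
      moreover have "diff_act (monom_poly (s + ?p)) G = 0"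
        using diff_act_mult[of "monom_poly s" "monom_poly ?p" G]
        unfolding monom_poly_mult kill cpoly_pair.linear_0[OF clinear_diff_act_right] .
      ultimately have "monom_poly (s + ?p) \<in> apolar_ideal V G \<inter> forms V a"
        using forms_subset_polys by (auto simp: apolar_ideal_def)
      then show "monom_poly s * monom_poly ?p \<in> Z"
        unfolding monom_poly_mult using degree_a by blast
    qed
  qed
  have mixed: "monom_poly t \<in> Z"
    if t: "Poly_Mapping.keys t \<subseteq> V" and i: "i \<in> A"
      and uv: "u \<in> Poly_Mapping.keys t" "u \<in> X i" "v \<in> Poly_Mapping.keys t" "v \<notin> X i" for t i u v
  proof -
    obtain j where j: "j \<in> A" "v \<in> X j" using t uv(3) by (auto simp: V_def)
    have ne: "u \<noteq> v" "i \<noteq> j" using uv j by auto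
    let ?p = "Poly_Mapping.single u 1 + Poly_Mapping.single v (1::nat)"
    have le: "Poly_Mapping.lookup ?p w \<le> Poly_Mapping.lookup t w" for w
      using uv(1,3) ne(1) by (auto simp: lookup_add lookup_single when_def in_keys_iff)
    then have eq: "t = (t - ?p) + ?p"
      by (intro poly_mapping_eqI) (simp only: lookup_add lookup_minus le_add_diff_inverse2)
    have "Poly_Mapping.keys (t - ?p) \<subseteq> V" using t keys_add_nat[of "t - ?p" ?p] eq by auto
    then have "monom_poly (t - ?p) * monom_poly ?p \<in> Z"
      using ideal_mult[OF Zi pair[OF i j(1) ne(2) uv(2) j(2)]] by (simp only: monom_poly_in_polys_iff)
    then show ?thesis unfolding monom_poly_mult eq[symmetric] .
  qed
  (* A polynomial in X i without constant term, times a monomial with a variable outside X i, has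
     only mixed monomials. *)
  have mixed_mult: "monom_poly s * \<Theta> \<in> Z"
    if i: "i \<in> A" and \<Theta>: "\<Theta> \<in> polys (X i)" "Poly_Mapping.lookup \<Theta> 0 = 0"
      and s: "Poly_Mapping.keys s \<subseteq> V" "\<not> Poly_Mapping.keys s \<subseteq> X i" for i \<Theta> s
  proof (rule clinear_in_subspace[OF clinear_mult_left Zsub])
    fix t assume t: "t \<in> Poly_Mapping.keys \<Theta>"
    then have tX: "Poly_Mapping.keys t \<subseteq> X i" using \<Theta>(1) by (simp add: in_polys_iff in_keys_iff)
    have "t \<noteq> 0" using t \<Theta>(2) by (auto simp: in_keys_iff)
    then have "Poly_Mapping.keys t \<noteq> {}" by simp
    then obtain u where u: "u \<in> Poly_Mapping.keys t" by blast
    obtain v where v: "v \<in> Poly_Mapping.keys s" "v \<notin> X i" using s(2) by blast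
    have "Poly_Mapping.keys (s + t) \<subseteq> V" using s(1) tX XV[OF i] by (auto simp: keys_add_nat)
    then show "monom_poly s * monom_poly t \<in> Z"
      unfolding monom_poly_mult using u v tX by (intro mixed[OF _ i, of _ u v]) (auto simp: keys_add_nat)
  qed

  (* Multiplied by a variable in X i, the restriction differs from the element of Z itself only by
     mixed monomials; multiplied by any other variable, it has only mixed monomials. *)
  have restrict_mem: "restrict_vars (X i) \<Theta> \<in> Z" if i: "i \<in> A" and \<Theta>: "\<Theta> \<in> Z" for i \<Theta>
  proof (rule saturated)
    have rX: "restrict_vars (X i) \<Theta> \<in> polys (X i)" by (rule restrict_vars_in_polys)
    then show rV: "restrict_vars (X i) \<Theta> \<in> polys V" using polys_mono[OF XV[OF i]] by blast
    have r0: "Poly_Mapping.lookup (restrict_vars (X i) \<Theta>) 0 = 0"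
      using const[OF \<Theta>] by (simp add: lookup_0_restrict_vars)
    fix s :: "'v \<Rightarrow>\<^sub>0 nat" assume s: "Poly_Mapping.keys s \<subseteq> V" "mono_deg s = 1"
    show "monom_poly s * restrict_vars (X i) \<Theta> \<in> Z"
    proof (cases "Poly_Mapping.keys s \<subseteq> X i")
      case False
      then show ?thesis using mixed_mult[OF i rX r0 s(1)] by blast
    next
      case True
      have "s \<noteq> 0" using s(2) by auto
      then have "Poly_Mapping.keys s \<noteq> {}" by simp
      then obtain u where u: "u \<in> Poly_Mapping.keys s" by blast
      have \<Theta>V: "\<Theta> \<in> polys V" using \<Theta> ZV by blast
      have "monom_poly s * (\<Theta> - restrict_vars (X i) \<Theta>) \<in> Z"
      proof (rule clinear_in_subspace[OF clinear_mult_left Zsub])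
        fix t assume "t \<in> Poly_Mapping.keys (\<Theta> - restrict_vars (X i) \<Theta>)"
        then have "Poly_Mapping.lookup \<Theta> t \<noteq> 0" "\<not> Poly_Mapping.keys t \<subseteq> X i"
          by (auto simp: in_keys_iff lookup_minus lookup_restrict_vars split: if_splits)
        moreover from this have "Poly_Mapping.keys t \<subseteq> V" using \<Theta>V by (simp add: in_polys_iff)
        moreover obtain v where "v \<in> Poly_Mapping.keys t" "v \<notin> X i" using calculation by blast
        ultimately show "monom_poly s * monom_poly t \<in> Z"
          unfolding monom_poly_mult using u True s(1)
          by (intro mixed[OF _ i, of _ u v]) (auto simp: keys_add_nat)
      qed
      moreover have "monom_poly s * \<Theta> \<in> Z"
        using ideal_mult[OF Zi \<Theta>] s(1) by (simp add: monom_poly_in_polys_iff)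
      ultimately have "monom_poly s * \<Theta> - monom_poly s * (\<Theta> - restrict_vars (X i) \<Theta>) \<in> Z"
        using cpoly.subspace_diff[OF Zsub] by blast
      then show ?thesis by (simp add: algebra_simps)
    qed
  qed

  define Zi' where "Zi' i = Z \<inter> polys (X i)" for i
  have "apolar (X i) (Zi' i) (F i)" if i: "i \<in> A" for i
  proof -
    have pV: "polys (X i) \<subseteq> polys V" using polys_mono[OF XV[OF i]] .
    have ideal_i: "ideal (Zi' i) (poly_ring (X i))"
      unfolding ideal_poly_ring_iff Zi'_def
    proof (intro conjI ballI)
      show "0 \<in> Z \<inter> polys (X i)" using cpoly.subspace_0[OF Zsub] cpoly.subspace_0[OF subspace_polys] by simp
      show "\<Theta> + \<Psi> \<in> Z \<inter> polys (X i)" if "\<Theta> \<in> Z \<inter> polys (X i)" "\<Psi> \<in> Z \<inter> polys (X i)" for \<Theta> \<Psi>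
        using that cpoly.subspace_add[OF Zsub] cpoly.subspace_add[OF subspace_polys[of "X i"]] by simp
      show "\<Psi> * \<Theta> \<in> Z \<inter> polys (X i)" if "\<Theta> \<in> Z \<inter> polys (X i)" "\<Psi> \<in> polys (X i)" for \<Theta> \<Psi>
        using that ideal_mult[OF Zi, of \<Theta> \<Psi>] pV mult_in_polys[of \<Psi> "X i" \<Theta>] by auto
    qed simp
    have homogeneous_i: "homogeneous (Zi' i)"
      unfolding homogeneous_def Zi'_def
    proof (intro ballI allI)
      fix \<Theta> m assume "\<Theta> \<in> Z \<inter> polys (X i)"
      moreover have "homogeneous Z" using Zc by (simp add: closed_subscheme_def)
      ultimately show "form_component m \<Theta> \<in> Z \<inter> polys (X i)"
        using homogeneousD[of Z \<Theta> m] form_component_in_forms[of \<Theta> "X i" m] forms_subset_polys[of "X i" m] by auto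
    qed
    have saturated_i: "\<Theta> \<in> Z"
      if \<Theta>: "\<Theta> \<in> polys (X i)" and N: "\<And>\<Psi>. \<Psi> \<in> forms (X i) N \<Longrightarrow> \<Psi> * \<Theta> \<in> Z" for \<Theta> N
    proof -
      have c: "Poly_Mapping.lookup \<Theta> 0 = 0"
      proof (rule ccontr)
        let ?c = "Poly_Mapping.lookup \<Theta> 0"
        assume c0: "?c \<noteq> 0"
        (* All forms of degree N in X i lie in Z; by saturation so do the variables in X i, so that
           F i would be annihilated by all monomials of degree d. *)
        have formN: "\<Psi> \<in> Z" if \<Psi>: "\<Psi> \<in> forms (X i) N" for \<Psi>
        proof -
          have "form_component (N + 0) (\<Psi> * \<Theta>) \<in> Z"
            using homogeneousD[OF _ N[OF \<Psi>]] Zc by (simp add: closed_subscheme_def)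
          then have "\<Psi> * Poly_Mapping.single 0 ?c \<in> Z"
            unfolding form_component_mult[OF \<Psi>] form_component_zero .
          then have "cscale (1 / ?c) (cscale ?c \<Psi>) \<in> Z"
            unfolding cscale_def[of ?c] by (intro cpoly.subspace_scale[OF Zsub]) (simp add: mult.commute)
          then show ?thesis using c0 by simp
        qed
        have var: "monom_poly (Poly_Mapping.single u 1) \<in> Z" if u: "u \<in> X i" for u
        proof (rule saturated)
          let ?u = "Poly_Mapping.single u (1 :: nat)"
          have uX: "monom_poly ?u \<in> polys (X i)" using u by (simp add: monom_poly_in_polys_iff)
          then show uV: "monom_poly ?u \<in> polys V" using pV by blast
          fix s assume s: "Poly_Mapping.keys s \<subseteq> V" "mono_deg s = N"
          show "monom_poly s * monom_poly ?u \<in> Z"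
          proof (cases "Poly_Mapping.keys s \<subseteq> X i")
            case True
            then have "monom_poly s \<in> Z" using s(2) formN by (simp add: monom_poly_in_forms_iff)
            then show ?thesis using ideal_mult[OF Zi _ uV] by (simp add: mult.commute)
          next
            case False
            have "?u \<noteq> 0" using mono_deg_single[of u 1] by (metis mono_deg_zero zero_neq_one)
            then have "Poly_Mapping.lookup (monom_poly ?u) 0 = (0 :: complex)"
              by (simp add: lookup_single when_def)
            then show ?thesis using mixed_mult[OF i uX _ s(1) False] by blast
          qed
        qed
        have "Poly_Mapping.keys (F i) \<noteq> {}" using F(2)[OF i] by simp
        then obtain t where t: "t \<in> Poly_Mapping.keys (F i)" by blast
        then have t': "Poly_Mapping.keys t \<subseteq> X i" "mono_deg t = d"
          using F(1)[OF i] by (auto simp: in_forms_iff in_keys_iff)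
        then have "t \<noteq> 0" using a by auto
        then have "Poly_Mapping.keys t \<noteq> {}" by simp
        then obtain u where u: "u \<in> Poly_Mapping.keys t" by blast
        let ?u = "Poly_Mapping.single u (1 :: nat)"
        have eq: "t = (t - ?u) + ?u"
          using u by (intro poly_mapping_eqI) (auto simp: lookup_add lookup_minus lookup_single when_def in_keys_iff)
        have "Poly_Mapping.keys (t - ?u) \<subseteq> V"
          using t'(1) XV[OF i] keys_add_nat[of "t - ?u" ?u] eq by auto
        then have "monom_poly (t - ?u) * monom_poly ?u \<in> Z"
          using ideal_mult[OF Zi var] u t'(1) by (auto simp: monom_poly_in_polys_iff)
        then have "monom_poly t \<in> Z" unfolding monom_poly_mult eq[symmetric] .
        then show False using top[OF i t] Zperp by (auto simp: apolar_ideal_def)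
      qed
      show "\<Theta> \<in> Z"
      proof (rule saturated)
        show "\<Theta> \<in> polys V" using \<Theta> pV by blast
        fix s :: "'v \<Rightarrow>\<^sub>0 nat" assume s: "Poly_Mapping.keys s \<subseteq> V" "mono_deg s = N"
        show "monom_poly s * \<Theta> \<in> Z"
          using N[of "monom_poly s"] mixed_mult[OF i \<Theta> c s(1)] s(2)
          by (cases "Poly_Mapping.keys s \<subseteq> X i") (auto simp: monom_poly_in_forms_iff)
      qed
    qed
    have "\<Theta> \<in> Zi' i" if "\<Theta> \<in> polys (X i)" "\<forall>\<Psi>\<in>forms (X i) N. \<Psi> * \<Theta> \<in> Zi' i" for \<Theta> N
      using saturated_i[OF that(1), of N] that by (simp add: Zi'_def)
    then have "closed_subscheme (X i) (Zi' i)"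
      using ideal_i homogeneous_i unfolding closed_subscheme_def by blast
    moreover have "Zi' i \<subseteq> apolar_ideal (X i) (F i)"
    proof
      fix \<Theta> assume "\<Theta> \<in> Zi' i"
      then have \<Theta>: "\<Theta> \<in> Z" "\<Theta> \<in> polys (X i)" by (simp_all add: Zi'_def)
      then have "diff_act \<Theta> G = 0" using Zperp by (auto simp: apolar_ideal_def)
      then show "\<Theta> \<in> apolar_ideal (X i) (F i)"
        using act_G_part[OF i \<Theta>(2) const[OF \<Theta>(1)]] \<Theta>(2) by (simp add: apolar_ideal_def)
    qed
    ultimately show ?thesis by (simp add: apolar_def)
  qed
  moreover have "Z = scheme_union A (\<lambda>i. embed_subscheme V (X i) (Zi' i))"
  proof
    show "Z \<subseteq> scheme_union A (\<lambda>i. embed_subscheme V (X i) (Zi' i))"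
      using ZV restrict_mem restrict_vars_in_polys by (auto simp: scheme_union_def embed_subscheme_def Zi'_def)
    show "scheme_union A (\<lambda>i. embed_subscheme V (X i) (Zi' i)) \<subseteq> Z"
    proof
      fix \<Theta> assume "\<Theta> \<in> scheme_union A (\<lambda>i. embed_subscheme V (X i) (Zi' i))"
      then have \<Theta>: "\<Theta> \<in> polys V" "\<And>i. i \<in> A \<Longrightarrow> restrict_vars (X i) \<Theta> \<in> Z"
        using A(2) by (auto simp: scheme_union_def embed_subscheme_def Zi'_def)
      (* The difference between the polynomial and the sum of its restrictions is mixed. *)
      define R where "R = (\<Sum>i\<in>A. restrict_vars (X i) \<Theta>)"
      have R: "R \<in> Z" unfolding R_def by (rule cpoly.subspace_sum[OF Zsub \<Theta>(2)])
      obtain i0 where i0: "i0 \<in> A" using A(2) by blast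
      have \<Theta>0: "Poly_Mapping.lookup \<Theta> 0 = 0"
        using const[OF \<Theta>(2)[OF i0]] by (simp add: lookup_0_restrict_vars)
      have "\<Theta> - R \<in> Z"
      proof (rule clinear_in_subspace[OF clinear_id Zsub])
        fix t assume t: "t \<in> Poly_Mapping.keys (\<Theta> - R)"
        have R_t: "Poly_Mapping.lookup R t = (\<Sum>i\<in>A. if Poly_Mapping.keys t \<subseteq> X i then Poly_Mapping.lookup \<Theta> t else 0)"
          unfolding R_def lookup_sum lookup_restrict_vars ..
        have t\<Theta>: "Poly_Mapping.lookup \<Theta> t \<noteq> 0"
        proof
          assume z: "Poly_Mapping.lookup \<Theta> t = 0"
          then have "Poly_Mapping.lookup R t = 0" unfolding R_t by (intro sum.neutral) simp
          then show False using t z by (simp add: in_keys_iff lookup_minus)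
        qed
        then have tV: "Poly_Mapping.keys t \<subseteq> V" using \<Theta>(1) by (simp add: in_polys_iff)
        have "t \<noteq> 0" using t\<Theta> \<Theta>0 by auto
        then have "Poly_Mapping.keys t \<noteq> {}" by simp
        then obtain u where u: "u \<in> Poly_Mapping.keys t" by blast
        then obtain i where i: "i \<in> A" "u \<in> X i" using tV by (auto simp: V_def)
        have "\<not> Poly_Mapping.keys t \<subseteq> X i"
        proof
          assume sub: "Poly_Mapping.keys t \<subseteq> X i"
          have "Poly_Mapping.lookup R t = (\<Sum>j\<in>A. if j = i then Poly_Mapping.lookup \<Theta> t else 0)"
            unfolding R_t
          proof (rule sum.cong[OF refl])
            fix j assume j: "j \<in> A"
            have "Poly_Mapping.keys t \<subseteq> X j \<longleftrightarrow> j = i" using sub u disj[OF i(1) j] by blast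
            then show "(if Poly_Mapping.keys t \<subseteq> X j then Poly_Mapping.lookup \<Theta> t else 0) =
                (if j = i then Poly_Mapping.lookup \<Theta> t else 0)" by simp
          qed
          then have "Poly_Mapping.lookup R t = Poly_Mapping.lookup \<Theta> t" using i(1) A(1) by simp
          then show False using t by (simp add: in_keys_iff lookup_minus)
        qed
        then obtain v where "v \<in> Poly_Mapping.keys t" "v \<notin> X i" by blast
        then show "monom_poly t \<in> Z" using mixed[OF tV i(1) u i(2)] by blast
      qed
      from cpoly.subspace_add[OF Zsub this R] show "\<Theta> \<in> Z" by simp
    qed
  qed
  ultimately show ?thesis unfolding V_def by blast
qed

section \<open>Cactus rank\<close>

lemma cactus_rank_attained:
  assumes "cactus_rank X F = enat r"
  obtains Z where "apolar X Z F" "zero_dimensional X Z" "has_degree X Z r"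
proof -
  let ?S = "{enat r |r. \<exists>Z. apolar X Z F \<and> zero_dimensional X Z \<and> has_degree X Z r}"
  have "?S \<noteq> {}"
  proof
    assume "?S = {}"
    then have "cactus_rank X F = Inf {}" unfolding cactus_rank_def by (rule arg_cong)
    then show False using assms by (simp add: top_enat_def)
  qed
  then have "cactus_rank X F \<in> ?S" unfolding cactus_rank_def by (metis (no_types, lifting) equals0I wellorder_InfI)
  then show ?thesis using assms that by auto
qed

lemma cactus_rank_le:
  "apolar X Z F \<Longrightarrow> zero_dimensional X Z \<Longrightarrow> has_degree X Z r \<Longrightarrow> cactus_rank X F \<le> enat r"
  unfolding cactus_rank_def by (rule Inf_lower) blast

lemma dim_derivs_le_cactus_rank:
  assumes "F \<in> polys X" "finite X"
  shows "enat (cpoly.dim (derivs d F a)) \<le> cactus_rank X F"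
  unfolding cactus_rank_def
proof (rule Inf_greatest, clarify)
  fix r Z assume Z: "apolar X Z F" "zero_dimensional X Z" "has_degree X Z r"
  have "cpoly.dim (derivs d F a) \<le> hilbert_function X Z (d - a)"
    using dim_derivs_le_hilbert_function[OF assms] Z(1) by (simp add: apolar_def)
  also have "\<dots> \<le> r" using hilbert_function_le_degree[OF _ assms(2) Z(3)] Z(1) by (simp add: apolar_def)
  finally show "enat (cpoly.dim (derivs d F a)) \<le> enat r" by simp
qed

theorem theorem3p4:
  fixes X :: "nat \<Rightarrow> 'v set" and F :: "nat \<Rightarrow> 'v cpoly" and k d a :: nat
  assumes "1 \<le> k"
    and "\<forall>i\<in>{1..k}. finite (X i)"
    and "disjoint_family_on X {1..k}"
    and "\<forall>i\<in>{1..k}. F i \<in> forms (X i) d \<and> F i \<noteq> 0"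
    and "1 \<le> a" and "a \<le> d - 1"
    and "\<forall>i\<in>{1..k}. cactus_rank (X i) (F i) = enat (cpoly.dim (derivs d (F i) a))"
  shows "cactus_rank (\<Union>i\<in>{1..k}. X i) (\<Sum>i=1..k. F i)
           = enat (cpoly.dim (derivs d (\<Sum>i=1..k. F i) a))
       \<and> cactus_rank (\<Union>i\<in>{1..k}. X i) (\<Sum>i=1..k. F i) = (\<Sum>i=1..k. cactus_rank (X i) (F i))
       \<and> (2 \<le> a \<longrightarrow>
           (\<forall>Z r. apolar (\<Union>i\<in>{1..k}. X i) Z (\<Sum>i=1..k. F i)
                \<and> zero_dimensional (\<Union>i\<in>{1..k}. X i) Z
                \<and> has_degree (\<Union>i\<in>{1..k}. X i) Z r
                \<and> enat r = cactus_rank (\<Union>i\<in>{1..k}. X i) (\<Sum>i=1..k. F i) \<longrightarrow>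
              (\<exists>Zi. (\<forall>i\<in>{1..k}. apolar (X i) (Zi i) (F i))
                  \<and> Z = scheme_union {1..k} (\<lambda>i. embed_subscheme (\<Union>i\<in>{1..k}. X i) (X i) (Zi i)))))"
proof -
  let ?A = "{1..k}" and ?V = "\<Union>i\<in>{1..k}. X i" and ?F = "\<Sum>i=1..k. F i"
  let ?r = "\<lambda>i. cpoly.dim (derivs d (F i) a)"
  have A: "finite ?A" "?A \<noteq> {}" using assms(1) by auto
  have X: "\<And>i. i \<in> ?A \<Longrightarrow> finite (X i)" using assms(2) by blast
  have F: "\<And>i. i \<in> ?A \<Longrightarrow> F i \<in> forms (X i) d" "\<And>i. i \<in> ?A \<Longrightarrow> F i \<noteq> 0" using assms(4) by blast+
  have a: "1 \<le> a" "a < d" using assms(5,6) by linarith+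
  have XV: "\<And>i. i \<in> ?A \<Longrightarrow> X i \<subseteq> ?V" by blast
  have finV: "finite ?V" using A X by blast
  have FX: "\<And>i. i \<in> ?A \<Longrightarrow> F i \<in> polys (X i)" using F(1) forms_subset_polys by blast
  have "?F \<in> polys ?V"
    using FX polys_mono[OF XV] by (intro cpoly.subspace_sum[OF subspace_polys]) blast
  then have lower: "enat (cpoly.dim (derivs d ?F a)) \<le> cactus_rank ?V ?F"
    using dim_derivs_le_cactus_rank finV by blast
  have dim_sum: "cpoly.dim (derivs d ?F a) = (\<Sum>i\<in>?A. ?r i)"
    by (rule dim_derivs_sum[OF A(1) X assms(3) F(1) a])
  have "\<exists>Z. apolar (X i) Z (F i) \<and> zero_dimensional (X i) Z \<and> has_degree (X i) Z (?r i)"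
    if "i \<in> ?A" for i
  proof -
    have "cactus_rank (X i) (F i) = enat (?r i)" using assms(7) that by blast
    then show ?thesis by (rule cactus_rank_attained) blast
  qed
  then obtain Y where Y: "\<And>i. i \<in> ?A \<Longrightarrow> apolar (X i) (Y i) (F i)"
    "\<And>i. i \<in> ?A \<Longrightarrow> zero_dimensional (X i) (Y i)" "\<And>i. i \<in> ?A \<Longrightarrow> has_degree (X i) (Y i) (?r i)"
    by metis
  have Yc: "\<And>i. i \<in> ?A \<Longrightarrow> closed_subscheme (X i) (Y i)" using Y(1) by (simp add: apolar_def)
  have "cactus_rank ?V ?F \<le> enat (\<Sum>i\<in>?A. ?r i)"
    using cactus_rank_le[OF apolar_union[OF A(2) XV FX Y(1)] zero_dimensional_union[OF A XV Yc Y(2)]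
        has_degree_union[OF A XV assms(3) finV Yc Y(3)]] .
  then have crk: "cactus_rank ?V ?F = enat (cpoly.dim (derivs d ?F a))"
    using lower dim_sum by (intro antisym) simp_all
  have "(\<Sum>i\<in>?A. cactus_rank (X i) (F i)) = (\<Sum>i\<in>?A. enat (?r i))"
    by (rule sum.cong) (use assms(7) in auto)
  also have "\<dots> = enat (\<Sum>i\<in>?A. ?r i)"
    by (induction rule: finite_induct[OF A(1)]) (simp_all add: zero_enat_def)
  finally have additive: "cactus_rank ?V ?F = (\<Sum>i\<in>?A. cactus_rank (X i) (F i))"
    using crk dim_sum by simp
  have "\<exists>Zi. (\<forall>i\<in>?A. apolar (X i) (Zi i) (F i)) \<and> Z = scheme_union ?A (\<lambda>i. embed_subscheme ?V (X i) (Zi i))"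
    if "2 \<le> a" and Z: "apolar ?V Z ?F" "has_degree ?V Z r" "enat r = cactus_rank ?V ?F" for Z r
  proof -
    have "r = cpoly.dim (derivs d ?F a)" using Z(3) crk by simp
    then have "has_degree ?V Z (cpoly.dim (derivs d ?F a))" using Z(2) by simp
    then show ?thesis
      using apolar_decomposition[OF A X assms(3) F \<open>2 \<le> a\<close> a(2) Z(1)] by blast
  qed
  then show ?thesis using crk additive by blast
qed

end
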